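(* Let $N>1$ be an integer and let $m,r_0>0$ be fixed. Then there exist $\hat b>0$ and a pair of functions $T,a:\,]-\hat b,\hat b[\,\to\mathbb{R}$ with $$T(0)=\frac{\pi}{2}\sqrt{\frac{r_0^3}{m\alpha_N}},\qquad a(0)=\sqrt{m\gamma_N r_0},$$ such that, for each $b\in\,]-\hat b,\hat b[$, the functions $r(t)=R(a(b),b,t)$ and $d(t)=D(a(b),b,t)$ are $4T(b)$-periodic. Moreover, for each $b\in\,]-\hat b,\hat b[$, the point $(a(b),b,T(b))$ solves the system (I).
   Context: Fix an integer $N>1$ and reals $m,r_0>0$. Define $$f(r,d)=\sum_{k=1}^{2N-1}\frac{\sin^2(k\pi/2N)}{\left[4r^2\sin^2(k\pi/2N)+((-1)^k-1)^2d^2\right]^{3/2}},\qquad g(r,d)=\sum_{k=1}^{2N-1}\frac{((-1)^k-1)^2}{\left[4r^2\sin^2(k\pi/2N)+((-1)^k-1)^2d^2\right]^{3/2}},$$ $$\alpha_N=\frac1{16}\sum_{k=1}^{2N-1}\frac{((-1)^k-1)^2}{\sin^3(k\pi/2N)},\qquad \gamma_N=\frac14\sum_{k=1}^{2N-1}\frac{1}{\sin(k\pi/2N)}.$$ For real $a,b$, the functions $t\mapsto R(a,b,t)=r(t)$ and $t\mapsto D(a,b,t)=d(t)$ denote the solution of the initial value problem $$\ddot r=\frac{a^2}{r^3}-2rm\,f(r,d),\qquad \ddot d=-\frac{m\,d}{2}\,g(r,d),$$ $$r(0)=r_0,\quad \dot r(0)=0,\quad d(0)=0,\quad \dot d(0)=b.$$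 (These are the reduced equations for $2N$ bodies of equal mass $m$ at the vertices of a regular antiprism, with $a$ the angular momentum, $r$ the distance of each body to the $z$-axis, and $d$ the oriented height.) Subscripts $t$ denote partial derivatives with respect to $t$. A point $(a,b,T)$ with $T>0$ solves the system (I) if $R_t(a,b,T)=0$ and $D_t(a,b,T)=0$. *)

theory Defs
  imports "HOL-Analysis.Analysis"
begin

definition antiprism_f :: "nat \<Rightarrow> real \<Rightarrow> real \<Rightarrow> real" where
  "antiprism_f N r d =
     (\<Sum>k = 1..2 * N - 1.
        (sin (real k * pi / (2 * real N)))\<^sup>2 /
        (4 * r\<^sup>2 * (sin (real k * pi / (2 * real N)))\<^sup>2 + ((-1) ^ k - 1)\<^sup>2 * d\<^sup>2) powr (3 / 2))"

definition antiprism_g :: "nat \<Rightarrow> real \<Rightarrow> real \<Rightarrow> real" where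
  "antiprism_g N r d =
     (\<Sum>k = 1..2 * N - 1.
        ((-1) ^ k - 1)\<^sup>2 /
        (4 * r\<^sup>2 * (sin (real k * pi / (2 * real N)))\<^sup>2 + ((-1) ^ k - 1)\<^sup>2 * d\<^sup>2) powr (3 / 2))"

definition antiprism_alpha :: "nat \<Rightarrow> real" where
  "antiprism_alpha N =
     1 / 16 * (\<Sum>k = 1..2 * N - 1. ((-1) ^ k - 1)\<^sup>2 / (sin (real k * pi / (2 * real N))) ^ 3)"

definition antiprism_gamma :: "nat \<Rightarrow> real" where
  "antiprism_gamma N = 1 / 4 * (\<Sum>k = 1..2 * N - 1. 1 / sin (real k * pi / (2 * real N)))"

text \<open>
  \<open>r\<close> and \<open>d\<close> solve the initial value problem on the open interval \<open>J\<close> around \<open>0\<close>. For \<open>N > 1\<close>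
  the equations are singular exactly at \<open>r = 0\<close>, so the condition \<open>r t > 0\<close> says that the solution
  starting at \<open>r 0 = r0 > 0\<close> stays in the domain of the vector field; without it, division by
  zero would assign a spurious meaning to the equations at a collision.
\<close>

definition ivp_solution ::
  "nat \<Rightarrow> real \<Rightarrow> real \<Rightarrow> real \<Rightarrow> real \<Rightarrow> real set \<Rightarrow> (real \<Rightarrow> real) \<Rightarrow> (real \<Rightarrow> real) \<Rightarrow> bool" where
  "ivp_solution N m r0 a b J r d \<longleftrightarrow>
     open J \<and> is_interval J \<and> 0 \<in> J \<and>
     (\<forall>t\<in>J. r t > 0) \<and>
     (\<exists>r' d'.
        (\<forall>t\<in>J.
           (r has_real_derivative r' t) (at t) \<and>
           (d has_real_derivative d' t) (at t) \<and>
           (r' has_real_derivative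
              a\<^sup>2 / (r t) ^ 3 - 2 * r t * m * antiprism_f N (r t) (d t)) (at t) \<and>
           (d' has_real_derivative
              - (m * d t / 2) * antiprism_g N (r t) (d t)) (at t)) \<and>
        r 0 = r0 \<and> r' 0 = 0 \<and> d 0 = 0 \<and> d' 0 = b)"

definition existence_interval :: "nat \<Rightarrow> real \<Rightarrow> real \<Rightarrow> real \<Rightarrow> real \<Rightarrow> real set" where
  "existence_interval N m r0 a b = \<Union>{J. \<exists>r d. ivp_solution N m r0 a b J r d}"

text \<open>
  The two components of the maximal solution at time \<open>t\<close>: the common value at \<open>t\<close> of all solutions
  whose interval contains \<open>t\<close>. They are meaningful for \<open>t\<close> in \<open>existence_interval\<close> only.
\<close>

definition R :: "nat \<Rightarrow> real \<Rightarrow> real \<Rightarrow> real \<Rightarrow> real \<Rightarrow> real \<Rightarrow> real" where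
  "R N m r0 a b t = (THE x. \<exists>J r d. ivp_solution N m r0 a b J r d \<and> t \<in> J \<and> x = r t)"

definition D :: "nat \<Rightarrow> real \<Rightarrow> real \<Rightarrow> real \<Rightarrow> real \<Rightarrow> real \<Rightarrow> real" where
  "D N m r0 a b t = (THE x. \<exists>J r d. ivp_solution N m r0 a b J r d \<and> t \<in> J \<and> x = d t)"

definition solves_system_I :: "nat \<Rightarrow> real \<Rightarrow> real \<Rightarrow> real \<Rightarrow> real \<Rightarrow> real \<Rightarrow> bool" where
  "solves_system_I N m r0 a b T \<longleftrightarrow>
     T > 0 \<and> T \<in> existence_interval N m r0 a b \<and>
     (R N m r0 a b has_real_derivative 0) (at T) \<and>
     (D N m r0 a b has_real_derivative 0) (at T)"

end

(*
Near the circular orbit r = r0, d = 0 write a^2 = m gamma_N r0 + delta. To first order,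
r' oscillates like delta sin(nu t) / (nu r0^3) and d' like b cos(omega t), where
nu^2 = m gamma_N / r0^3 and omega^2 = m alpha_N / r0^3. The inequality gamma_N < 4 alpha_N gives
sin(nu t) > 0 at t = pi / (2 omega), so for small b <> 0 the pair (r', d' / b) changes sign
across opposite sides of a small rectangle in the (delta, t)-plane, and the Poincare-Miranda
theorem (a consequence of Brouwer's fixed point theorem) yields a common zero (delta, T). No
continuity in b is claimed, so zeros may be chosen independently for each b. The solution is
symmetric under reflection about the times 0 (with d -> -d) and T, which makes it global and
4T-periodic. To work with globally Lipschitz equations throughout, r is replaced by max r c.
*)
theory Submission
  imports Defs
begin

section \<open>Globally Lipschitz differential equations\<close>

text \<open>At b = 0 the height vanishes identically, so the equation for d' carries no information
  there and has to be divided by b. An implicit function argument would then need derivatives of the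
  flow in its parameters; sign changes need only continuity and error bounds, provided that the
  errors are of the right kind. The error in d' must carry a factor |b| that survives the division,
  which is why the height is bounded by a multiple of |b| alone. The error in r' may contain a plain
  multiple of |b|, because |b| is kept below the square of the half-width of the range of delta. The
  inequality gamma_N < 4 alpha_N acts as nu < 2 omega: it places nu * pi / (2 omega) below pi, so
  the radial response to delta has not yet returned to zero when the vertical velocity first
  vanishes. At b = 0 every time is a turning time of the circular orbit, which leaves T(0) free to
  be prescribed. The truncation is inactive on [0, T], and the two reflections carry the lower bound
  on r from there to all times.\<close>

lemma has_vector_derivative_mirror_shift:
  fixes x :: "real \<Rightarrow> 'a::real_normed_vector"
  assumes "(x has_vector_derivative v) (at (c - t))"
  shows "((\<lambda>s. x (c - s)) has_vector_derivative - v) (at t)"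
proof -
  have "((\<lambda>s. c - s) has_vector_derivative (-1)) (at t)"
    by (auto intro!: derivative_eq_intros)
  from vector_diff_chain_at[OF this assms] show ?thesis
    by (simp add: o_def)
qed

text \<open>For \<open>K \<ge> 1\<close> the constant \<kappa> is at most K * \<kappa>, so u +
  \<kappa> satisfies the homogeneous inequality and (u + \<kappa>) * exp (- K * t) is
  nonincreasing.\<close>

lemma gronwall_exp_bound:
  fixes u u' :: "real \<Rightarrow> real"
  assumes deriv: "\<And>t. 0 \<le> t \<Longrightarrow> t \<le> S \<Longrightarrow> (u has_real_derivative u' t) (at t)"
    and bound: "\<And>t. 0 \<le> t \<Longrightarrow> t \<le> S \<Longrightarrow> u' t \<le> K * u t + \<kappa>"
    and "K \<ge> 1" "\<kappa> \<ge> 0" "0 \<le> t" "t \<le> S"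
  shows "u t \<le> (u 0 + \<kappa>) * exp (K * t)"
proof -
  define w where "w s = (u s + \<kappa>) * exp (- K * s)" for s
  have "w t \<le> w 0"
  proof (rule DERIV_nonpos_imp_nonincreasing[OF \<open>0 \<le> t\<close>])
    fix s assume s: "0 \<le> s" "s \<le> t"
    have "(w has_real_derivative (u' s - K * (u s + \<kappa>)) * exp (- K * s)) (at s)"
      unfolding w_def using s assms
      by (auto intro!: derivative_eq_intros deriv simp: algebra_simps)
    moreover have "u' s - K * (u s + \<kappa>) \<le> 0"
    proof -
      have "\<kappa> \<le> K * \<kappa>"
        using assms(3,4) mult_right_mono[of 1 K \<kappa>] by simp
      then show ?thesis
        using bound[of s] s assms(6) by (simp add: distrib_left)
    qed
    then have "(u' s - K * (u s + \<kappa>)) * exp (- K * s) \<le> 0"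
      by (simp add: mult_nonpos_nonneg)
    ultimately show "\<exists>y. (w has_real_derivative y) (at s) \<and> y \<le> 0"
      by blast
  qed
  then have "(u t + \<kappa>) * exp (- K * t) * exp (K * t) \<le> (u 0 + \<kappa>) * exp (K * t)"
    unfolding w_def by (intro mult_right_mono) auto
  then have "u t + \<kappa> \<le> (u 0 + \<kappa>) * exp (K * t)"
    by (simp add: mult.assoc flip: exp_add)
  then show ?thesis
    using \<open>\<kappa> \<ge> 0\<close> by simp
qed

text \<open>Gronwall for the squared distance: Cauchy-Schwarz and the Lipschitz bound contribute 2 *
  L, and 2 * |z| * \<epsilon> \<le> |z|^2 + \<epsilon>^2 contributes the extra 1. With \<epsilon> =
  0 it yields uniqueness; with \<open>y\<close> a solution for another parameter value it yields
  dependence on parameters.\<close>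

lemma approximate_solution_dist:
  fixes x y :: "real \<Rightarrow> 'a::real_inner"
  assumes lip: "L-lipschitz_on UNIV V"
    and x: "\<And>t. 0 \<le> t \<Longrightarrow> t \<le> S \<Longrightarrow> (x has_vector_derivative V (x t)) (at t)"
    and y: "\<And>t. 0 \<le> t \<Longrightarrow> t \<le> S \<Longrightarrow> (y has_vector_derivative y' t) (at t)"
    and err: "\<And>t. 0 \<le> t \<Longrightarrow> t \<le> S \<Longrightarrow> norm (V (y t) - y' t) \<le> \<epsilon>"
    and t: "0 \<le> t" "t \<le> S"
  shows "(norm (x t - y t))\<^sup>2 \<le> ((norm (x 0 - y 0))\<^sup>2 + \<epsilon>\<^sup>2) * exp ((2 * L + 1) * t)"
proof -
  define z where "z s = x s - y s" for s
  have "L \<ge> 0" using lip by (rule lipschitz_on_nonneg)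
  have z: "(z has_vector_derivative (V (x s) - y' s)) (at s)" if "0 \<le> s" "s \<le> S" for s
    unfolding z_def using x[OF that] y[OF that] by (rule has_vector_derivative_diff)
  have "((\<lambda>s. z s \<bullet> z s) has_real_derivative 2 * (z s \<bullet> (V (x s) - y' s))) (at s)"
    if "0 \<le> s" "s \<le> S" for s
  proof -
    have "((\<lambda>s. z s \<bullet> z s) has_vector_derivative
        z s \<bullet> (V (x s) - y' s) + (V (x s) - y' s) \<bullet> z s) (at s)"
      using bounded_bilinear.has_vector_derivative[OF bounded_bilinear_inner z[OF that] z[OF that]] .
    then show ?thesis
      by (simp add: has_real_derivative_iff_has_vector_derivative inner_commute)
  qed
  moreover have "2 * (z s \<bullet> (V (x s) - y' s)) \<le> (2 * L + 1) * (z s \<bullet> z s) + \<epsilon>\<^sup>2"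
    if "0 \<le> s" "s \<le> S" for s
  proof -
    have "z s \<bullet> (V (x s) - y' s) = z s \<bullet> (V (x s) - V (y s)) + z s \<bullet> (V (y s) - y' s)"
      by (simp add: inner_diff_right)
    also have "z s \<bullet> (V (x s) - V (y s)) \<le> norm (z s) * norm (V (x s) - V (y s))"
      by (rule norm_cauchy_schwarz)
    also have "\<dots> \<le> norm (z s) * (L * norm (z s))"
      using lipschitz_onD[OF lip, of "x s" "y s"]
      by (intro mult_left_mono) (auto simp: dist_norm z_def)
    also have "z s \<bullet> (V (y s) - y' s) \<le> norm (z s) * norm (V (y s) - y' s)"
      by (rule norm_cauchy_schwarz)
    also have "\<dots> \<le> norm (z s) * \<epsilon>"
      using err[OF that] by (intro mult_left_mono) auto
    finally have "2 * (z s \<bullet> (V (x s) - y' s)) \<le> 2 * (norm (z s) * (L * norm (z s))) + 2 * norm (z s) * \<epsilon>"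
      by simp
    also have "2 * norm (z s) * \<epsilon> \<le> (norm (z s))\<^sup>2 + \<epsilon>\<^sup>2"
      by (rule sum_squares_bound)
    finally show ?thesis
      by (simp add: dot_square_norm power2_eq_square algebra_simps)
  qed
  ultimately have "z t \<bullet> z t \<le> (z 0 \<bullet> z 0 + \<epsilon>\<^sup>2) * exp ((2 * L + 1) * t)"
    using t \<open>L \<ge> 0\<close> by (intro gronwall_exp_bound[where u' = "\<lambda>s. 2 * (z s \<bullet> (V (x s) - y' s))"]) auto
  then show ?thesis
    by (simp add: dot_square_norm z_def)
qed

text \<open>Negative times reduce to positive ones by reversing time, which replaces V by -V. The
  equation is required only between 0 and t, so that solutions on bounded intervals can be
  compared.\<close>

lemma lipschitz_ode_unique:
  fixes x y :: "real \<Rightarrow> 'a::real_inner"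
  assumes lip: "L-lipschitz_on UNIV V"
    and x: "\<And>s. s \<in> closed_segment 0 t \<Longrightarrow> (x has_vector_derivative V (x s)) (at s)"
    and y: "\<And>s. s \<in> closed_segment 0 t \<Longrightarrow> (y has_vector_derivative V (y s)) (at s)"
    and "x 0 = y 0"
  shows "x t = y t"
proof (cases "t \<ge> 0")
  case True
  have "(norm (x t - y t))\<^sup>2 \<le> ((norm (x 0 - y 0))\<^sup>2 + 0\<^sup>2) * exp ((2 * L + 1) * t)"
    by (rule approximate_solution_dist[OF lip, where S = t and y' = "\<lambda>s. V (y s)"])
      (use x y True in \<open>auto simp: closed_segment_eq_real_ivl\<close>)
  then show ?thesis using assms(4) by simp
next
  case False
  have lip': "L-lipschitz_on UNIV (\<lambda>z. - V z)"
    using lip by (simp add: lipschitz_on_minus)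
  have *: "((\<lambda>s. w (0 - s)) has_vector_derivative - V (w (0 - s))) (at s)"
    if "0 \<le> s" "s \<le> -t" and w: "\<And>s. s \<in> closed_segment 0 t \<Longrightarrow> (w has_vector_derivative V (w s)) (at s)"
    for s w
    using False that by (intro has_vector_derivative_mirror_shift) (auto simp: closed_segment_eq_real_ivl)
  have "(norm (x (0 - (-t)) - y (0 - (-t))))\<^sup>2 \<le>
      ((norm (x (0 - 0) - y (0 - 0)))\<^sup>2 + 0\<^sup>2) * exp ((2 * L + 1) * (-t))"
    by (rule approximate_solution_dist[OF lip', where S = "-t" and y' = "\<lambda>s. - V (y (0 - s))"])
      (use False in \<open>auto intro!: *[simplified] x y\<close>)
  then show ?thesis using assms(4) by simp
qed

text \<open>Integrating the weight exp (M * |t|) gains a factor 1 / M. In the Picard iteration M is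
  twice the Lipschitz constant, whence the contraction factor 1 / 2.\<close>

lemma exp_derivative_bound:
  fixes F :: "real \<Rightarrow> 'a::real_normed_vector"
  assumes deriv: "\<And>t. (F has_vector_derivative F' t) (at t)"
    and bound: "\<And>t. norm (F' t) \<le> B * exp (M * \<bar>t\<bar>)"
    and "F 0 = 0" "M > 0" "B \<ge> 0"
  shows "norm (F t) \<le> B / M * exp (M * \<bar>t\<bar>)"
proof -
  have *: "norm (G s) \<le> B / M * exp (M * s)"
    if G: "\<And>t. (G has_vector_derivative G' t) (at t)"
      and G': "\<And>t. norm (G' t) \<le> B * exp (M * \<bar>t\<bar>)" and "G 0 = 0" and "s > 0"
    for G :: "real \<Rightarrow> 'a" and G' s
  proof -
    have "norm (G s - G 0) \<le> B / M * exp (M * s) - B / M * exp (M * 0)"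
    proof (rule differentiable_bound_general[OF \<open>s > 0\<close>])
      show "continuous_on {0..s} G"
        using G by (meson continuous_at_imp_continuous_on has_vector_derivative_continuous)
      show "continuous_on {0..s} (\<lambda>s. B / M * exp (M * s))"
        by (intro continuous_intros)
      fix x assume x: "0 < x" "x < s"
      show "(G has_vector_derivative G' x) (at x)" by (rule G)
      show "((\<lambda>s. B / M * exp (M * s)) has_vector_derivative B * exp (M * x)) (at x)"
        unfolding has_real_derivative_iff_has_vector_derivative[symmetric]
        using \<open>M > 0\<close> by (auto intro!: derivative_eq_intros)
      show "norm (G' x) \<le> B * exp (M * x)"
        using G'[of x] x by simp
    qed
    moreover have "B / M \<ge> 0" using assms by simp
    ultimately show ?thesis using that by simp
  qed
  consider "t = 0" | "t > 0" | "t < 0" by linarith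
  then show ?thesis
  proof cases
    case 1 then show ?thesis using assms by simp
  next
    case 2 then show ?thesis using *[OF deriv bound, of t] assms by simp
  next
    case 3
    have "norm ((\<lambda>s. F (0 - s)) (- t)) \<le> B / M * exp (M * (- t))"
    proof (rule *)
      fix s
      show "((\<lambda>s. F (0 - s)) has_vector_derivative - F' (0 - s)) (at s)" for s
        by (rule has_vector_derivative_mirror_shift) (rule deriv)
      show "norm (- F' (0 - s)) \<le> B * exp (M * \<bar>s\<bar>)" for s
        using bound[of "-s"] by simp
    qed (use 3 assms in auto)
    then show ?thesis using 3 by simp
  qed
qed

text \<open>Picard iteration; the weight \<open>exp (2 * K * \<bar>t\<bar>)\<close> makes each step a contraction by one half
  on the whole line at once.\<close>

lemma lipschitz_ode_exists:
  fixes V :: "'a::euclidean_space \<Rightarrow> 'a"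
  assumes "L-lipschitz_on UNIV V"
  obtains x where "x 0 = x0" "\<And>t. (x has_vector_derivative V (x t)) (at t)"
proof -
  \<comment> \<open>Positive even if L = 0, so that 2 * K can serve as a divisor.\<close>
  define K where "K = L + 1"
  have "L \<ge> 0" using assms by (rule lipschitz_on_nonneg)
  then have "K > 0" by (simp add: K_def)
  have V: "norm (V y - V z) \<le> K * norm (y - z)" for y z
  proof -
    have "norm (V y - V z) \<le> L * norm (y - z)"
      using lipschitz_onD[OF assms] by (simp add: dist_norm)
    also have "\<dots> \<le> K * norm (y - z)" by (intro mult_right_mono) (auto simp: K_def)
    finally show ?thesis .
  qed
  have contV: "continuous_on UNIV V" using assms by (rule lipschitz_on_continuous_on)
  have "\<exists>F. F 0 = x0 \<and> (\<forall>t. (F has_vector_derivative f t) (at t))"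
    if "continuous_on UNIV f" for f :: "real \<Rightarrow> 'a"
  proof -
    obtain F where F: "\<And>t. (F has_vector_derivative f t) (at t)"
      using einterval_antiderivative[of "-\<infinity>" "\<infinity>" f] \<open>continuous_on UNIV f\<close>
      by (auto simp: continuous_on_eq_continuous_at)
    show ?thesis
      by (rule exI[of _ "\<lambda>t. F t + (x0 - F 0)"]) (auto intro!: derivative_eq_intros F)
  qed
  then obtain P where P: "\<And>f. continuous_on UNIV f \<Longrightarrow>
      P f 0 = x0 \<and> (\<forall>t. (P f has_vector_derivative f t) (at t))" by metis
  define X where "X = rec_nat (\<lambda>_::real. x0) (\<lambda>_ f. P (\<lambda>t. V (f t)))"
  have X0: "X 0 = (\<lambda>_. x0)" and XS: "X (Suc n) = P (\<lambda>t. V (X n t))" for n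
    by (simp_all add: X_def)
  have contX: "continuous_on UNIV (X n)" for n
  proof (induction n)
    case (Suc n)
    have "continuous_on UNIV (\<lambda>t. V (X n t))"
      by (rule continuous_on_compose2[OF contV Suc]) auto
    from P[OF this] show ?case unfolding XS
      by (auto intro!: continuous_at_imp_continuous_on has_vector_derivative_continuous)
  qed (simp add: X0)
  have "continuous_on UNIV (\<lambda>t. V (X n t))" for n
    by (rule continuous_on_compose2[OF contV contX]) auto
  note PX = P[OF this, folded XS]
  have X_0: "X n 0 = x0" for n using PX by (cases n) (auto simp: X0)
  have X_deriv: "(X (Suc n) has_vector_derivative V (X n t)) (at t)" for n t
    using PX by auto
  define A where "A = norm (V x0) / (2 * K)"
  have "A \<ge> 0" using \<open>K > 0\<close> by (simp add: A_def)
  have step: "norm (X (Suc n) t - X n t) \<le> A * (1/2) ^ n * exp (2 * K * \<bar>t\<bar>)" for n t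
  proof (induction n arbitrary: t)
    case 0
    have "norm (X (Suc 0) t - x0) \<le> norm (V x0) / (2 * K) * exp (2 * K * \<bar>t\<bar>)"
    proof (rule exp_derivative_bound)
      show "((\<lambda>t. X (Suc 0) t - x0) has_vector_derivative V x0) (at t)" for t
        using X_deriv[of 0 t] by (auto intro!: derivative_eq_intros simp: X0)
      show "norm (V x0) \<le> norm (V x0) * exp (2 * K * \<bar>t\<bar>)" for t
        using mult_left_mono[of 1 "exp (2 * K * \<bar>t\<bar>)" "norm (V x0)"] \<open>K > 0\<close> by simp
    qed (use \<open>K > 0\<close> X_0 in auto)
    then show ?case by (simp add: A_def X0)
  next
    case (Suc n)
    have "norm (X (Suc (Suc n)) t - X (Suc n) t) \<le> K * (A * (1/2) ^ n) / (2 * K) * exp (2 * K * \<bar>t\<bar>)"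
    proof (rule exp_derivative_bound)
      show "((\<lambda>t. X (Suc (Suc n)) t - X (Suc n) t) has_vector_derivative
          V (X (Suc n) t) - V (X n t)) (at t)" for t
        using X_deriv by (auto intro!: derivative_eq_intros)
      show "norm (V (X (Suc n) t) - V (X n t)) \<le> K * (A * (1/2) ^ n) * exp (2 * K * \<bar>t\<bar>)" for t
        by (rule order_trans[OF V]) (use mult_left_mono[OF Suc[of t], of K] \<open>K > 0\<close> in \<open>simp add: mult_ac\<close>)
    qed (use \<open>K > 0\<close> \<open>A \<ge> 0\<close> X_0 in auto)
    then show ?case using \<open>K > 0\<close> by simp
  qed
  define x where "x t = x0 + (\<Sum>n. X (Suc n) t - X n t)" for t
  have unif: "uniform_limit {-S..S} X x sequentially" for S
  proof -
    have "uniform_limit {-S..S} (\<lambda>n t. \<Sum>i<n. X (Suc i) t - X i t)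
        (\<lambda>t. \<Sum>n. X (Suc n) t - X n t) sequentially"
    proof (rule Weierstrass_m_test)
      fix n t assume "t \<in> {-S..S}"
      then have "exp (2 * K * \<bar>t\<bar>) \<le> exp (2 * K * S)" using \<open>K > 0\<close> by auto
      with step[of n t] show "norm (X (Suc n) t - X n t) \<le> (A * exp (2 * K * S)) * (1/2) ^ n"
        using \<open>A \<ge> 0\<close> mult_left_mono[of "exp (2 * K * \<bar>t\<bar>)" "exp (2 * K * S)" "A * (1/2) ^ n"]
        by (simp add: mult_ac)
    next
      show "summable (\<lambda>n. A * exp (2 * K * S) * (1/2) ^ n)"
        by (intro summable_mult summable_geometric) auto
    qed
    from uniform_limit_add[OF uniform_limit_const[where c = "\<lambda>_. x0"] this]
    have "uniform_limit {-S..S} (\<lambda>n t. x0 + (\<Sum>i<n. X (Suc i) t - X i t)) x sequentially"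
      by (simp add: x_def[abs_def])
    moreover have "x0 + (\<Sum>i<n. X (Suc i) t - X i t) = X n t" for n t
      by (induction n) (auto simp: X0 algebra_simps)
    ultimately show ?thesis by simp
  qed
  have lim: "(\<lambda>n. X n t) \<longlonglongrightarrow> x t" for t
    by (rule tendsto_uniform_limitI[OF unif[of "\<bar>t\<bar>"]]) (simp add: abs_real_def)
  show thesis
  proof
    show "x 0 = x0" using lim[of 0] by (simp add: X_0 LIMSEQ_const_iff)
    fix t :: real
    define S where "S = \<bar>t\<bar> + 1"
    \<comment> \<open>The derivative of \<open>X (Suc n)\<close> is V applied to \<open>X n\<close>,
      which converges uniformly on the window because V is Lipschitz; hence the limit is
      differentiable with the limiting derivative. The window has radius |t| + 1 to make t an
      interior point.\<close>
    have "\<exists>g. \<forall>s\<in>{-S..S}. (\<lambda>n. X (Suc n) s) \<longlonglongrightarrow> g s \<and>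
        (g has_derivative (\<lambda>h. h *\<^sub>R V (x s))) (at s within {-S..S})"
    proof (rule has_derivative_sequence[where f' = "\<lambda>n s h. h *\<^sub>R V (X n s)"])
      show "(X (Suc n) has_derivative (\<lambda>h. h *\<^sub>R V (X n s))) (at s within {-S..S})" for n s
        using has_vector_derivative_at_within[OF X_deriv] by (simp add: has_vector_derivative_def)
      show "(\<lambda>n. X (Suc n) 0) \<longlonglongrightarrow> x0" by (simp add: X_0)
      show "0 \<in> {-S..S}" by (simp add: S_def)
      fix e :: real assume "e > 0"
      then have "\<forall>\<^sub>F n in sequentially. \<forall>s\<in>{-S..S}. dist (X n s) (x s) < e / K"
        using \<open>K > 0\<close> by (intro uniform_limitD[OF unif]) auto
      then show "\<forall>\<^sub>F n in sequentially. \<forall>s\<in>{-S..S}. \<forall>h.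
          norm (h *\<^sub>R V (X n s) - h *\<^sub>R V (x s)) \<le> e * norm h"
      proof eventually_elim
        case (elim n)
        show ?case
        proof (intro ballI allI)
          fix s h :: real assume "s \<in> {-S..S}"
          have "norm (V (X n s) - V (x s)) \<le> K * norm (X n s - x s)" by (rule V)
          also have "\<dots> \<le> e"
            using elim \<open>s \<in> _\<close> \<open>K > 0\<close> by (force simp: dist_norm field_simps)
          finally have "norm (V (X n s) - V (x s)) * norm h \<le> e * norm h"
            by (rule mult_right_mono) simp
          then show "norm (h *\<^sub>R V (X n s) - h *\<^sub>R V (x s)) \<le> e * norm h"
            unfolding scaleR_diff_right[symmetric] norm_scaleR by (simp add: mult.commute)
        qed
      qed
    qed auto
    then obtain g where g: "\<And>s. s \<in> {-S..S} \<Longrightarrow> (\<lambda>n. X (Suc n) s) \<longlonglongrightarrow> g s"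
      "\<And>s. s \<in> {-S..S} \<Longrightarrow> (g has_derivative (\<lambda>h. h *\<^sub>R V (x s))) (at s within {-S..S})"
      by blast
    have gx: "g s = x s" if "s \<in> {-S..S}" for s
      using g(1)[OF that] LIMSEQ_Suc[OF lim] by (rule LIMSEQ_unique)
    have t: "t \<in> {-S<..<S}" by (auto simp: S_def)
    have "(g has_vector_derivative V (x t)) (at t within {-S<..<S})"
      unfolding has_vector_derivative_def
      by (rule has_derivative_subset[OF g(2)]) (use t in auto)
    then have "(g has_vector_derivative V (x t)) (at t)"
      by (simp only: at_within_open[OF t open_greaterThanLessThan])
    then show "(x has_vector_derivative V (x t)) (at t)"
      by (rule has_vector_derivative_transform_within_open[OF _ _ t]) (auto intro: gx)
  qed
qed

section \<open>Bounded Lipschitz functions and the antiprism force\<close>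

text \<open>Boundedness is included because Lipschitz functions alone are not closed under products.
  With it they form an algebra, in which the force is assembled from a few simple quotients.\<close>

definition bounded_lipschitz :: "('a::metric_space \<Rightarrow> real) \<Rightarrow> bool" where
  "bounded_lipschitz f \<longleftrightarrow> (\<exists>B. \<forall>x. \<bar>f x\<bar> \<le> B) \<and> (\<exists>L. L-lipschitz_on UNIV f)"

lemma bounded_lipschitzI:
  assumes "\<And>x. \<bar>f x\<bar> \<le> B" "\<And>x y. \<bar>f x - f y\<bar> \<le> L * dist x y" "L \<ge> 0"
  shows "bounded_lipschitz f"
  unfolding bounded_lipschitz_def
proof
  show "\<exists>L. L-lipschitz_on UNIV f"
    using assms(2,3) by (auto intro!: exI[of _ L] lipschitz_onI simp: dist_real_def)
qed (use assms(1) in blast)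

lemma bounded_lipschitzE:
  assumes "bounded_lipschitz f"
  obtains B L where "B > 0" "L > 0" "\<And>x. \<bar>f x\<bar> \<le> B" "\<And>x y. \<bar>f x - f y\<bar> \<le> L * dist x y"
    "L-lipschitz_on UNIV f"
proof -
  obtain B L where B: "\<And>x. \<bar>f x\<bar> \<le> B" and L: "L-lipschitz_on UNIV f"
    using assms by (auto simp: bounded_lipschitz_def)
  have L': "(\<bar>L\<bar> + 1)-lipschitz_on UNIV f"
    by (rule lipschitz_on_le[OF L]) simp
  show thesis
  proof
    show "\<bar>f x\<bar> \<le> \<bar>B\<bar> + 1" for x using B[of x] by simp
    show "\<bar>f x - f y\<bar> \<le> (\<bar>L\<bar> + 1) * dist x y" for x y
      using lipschitz_onD[OF L', of x y] by (simp add: dist_real_def)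
  qed (use L' in auto)
qed

lemma bounded_lipschitz_const: "bounded_lipschitz (\<lambda>x. c)"
  by (rule bounded_lipschitzI[of _ "\<bar>c\<bar>" 0]) auto

lemma bounded_lipschitz_add:
  assumes "bounded_lipschitz f" "bounded_lipschitz g"
  shows "bounded_lipschitz (\<lambda>x. f x + g x)"
proof -
  obtain B L where f: "\<And>x. \<bar>f x\<bar> \<le> B" "\<And>x y. \<bar>f x - f y\<bar> \<le> L * dist x y" "L > 0"
    using assms(1) by (elim bounded_lipschitzE) blast
  obtain C M where g: "\<And>x. \<bar>g x\<bar> \<le> C" "\<And>x y. \<bar>g x - g y\<bar> \<le> M * dist x y" "M > 0"
    using assms(2) by (elim bounded_lipschitzE) blast
  show ?thesis
  proof (rule bounded_lipschitzI[of _ "B + C" "L + M"])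
    show "\<bar>f x + g x\<bar> \<le> B + C" for x using f(1)[of x] g(1)[of x] by linarith
    show "\<bar>f x + g x - (f y + g y)\<bar> \<le> (L + M) * dist x y" for x y
      unfolding distrib_right using f(2)[of x y] g(2)[of x y] by linarith
  qed (use f g in simp)
qed

lemma bounded_lipschitz_mult:
  assumes "bounded_lipschitz f" "bounded_lipschitz g"
  shows "bounded_lipschitz (\<lambda>x. f x * g x)"
proof -
  obtain B L where f: "\<And>x. \<bar>f x\<bar> \<le> B" "\<And>x y. \<bar>f x - f y\<bar> \<le> L * dist x y" "L > 0" "B > 0"
    using assms(1) by (elim bounded_lipschitzE) blast
  obtain C M where g: "\<And>x. \<bar>g x\<bar> \<le> C" "\<And>x y. \<bar>g x - g y\<bar> \<le> M * dist x y" "M > 0" "C > 0"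
    using assms(2) by (elim bounded_lipschitzE) blast
  show ?thesis
  proof (rule bounded_lipschitzI[of _ "B * C" "L * C + B * M"])
    show "\<bar>f x * g x\<bar> \<le> B * C" for x
      unfolding abs_mult using f g by (intro mult_mono) auto
    show "\<bar>f x * g x - f y * g y\<bar> \<le> (L * C + B * M) * dist x y" for x y
    proof -
      have "f x * g x - f y * g y = (f x - f y) * g x + f y * (g x - g y)"
        by (simp add: algebra_simps)
      also have "\<bar>\<dots>\<bar> \<le> \<bar>f x - f y\<bar> * \<bar>g x\<bar> + \<bar>f y\<bar> * \<bar>g x - g y\<bar>"
        by (metis abs_mult abs_triangle_ineq)
      also have "\<dots> \<le> (L * dist x y) * C + B * (M * dist x y)"
        using f g by (intro add_mono mult_mono) auto
      finally show ?thesis by (simp add: algebra_simps)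
    qed
  qed (use f g in simp)
qed

lemma bounded_lipschitz_sum:
  "(\<And>k. k \<in> I \<Longrightarrow> bounded_lipschitz (f k)) \<Longrightarrow> bounded_lipschitz (\<lambda>x. \<Sum>k\<in>I. f k x)"
  by (induction I rule: infinite_finite_induct) (auto intro: bounded_lipschitz_const bounded_lipschitz_add)

text \<open>Numerator and denominator may both be unbounded: it suffices that the denominator
  dominates the numerator and stays away from 0. The difference of two quotients is split into the
  change of \<open>p\<close> and the change of \<open>n\<close>, the latter multiplied by the
  bounded value \<open>p y / n y\<close>.\<close>

lemma bounded_lipschitz_quotient:
  assumes p: "L-lipschitz_on UNIV p" and n: "M-lipschitz_on UNIV n"
    and "k > 0" and ge: "\<And>x. n x \<ge> k" and le: "\<And>x. \<bar>p x\<bar> \<le> B * n x"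
  shows "bounded_lipschitz (\<lambda>x. p x / n x)"
proof (rule bounded_lipschitzI[of _ B "L / k + B * M / k"])
  have pos: "n x > 0" for x using ge[of x] \<open>k > 0\<close> by linarith
  show bound: "\<bar>p x / n x\<bar> \<le> B" for x
    using le[of x] pos[of x] by (simp add: field_simps)
  have "B \<ge> 0" using bound[of undefined] by linarith
  moreover have "L \<ge> 0" "M \<ge> 0" using p n by (auto dest: lipschitz_on_nonneg)
  ultimately show "L / k + B * M / k \<ge> 0" using \<open>k > 0\<close> by simp
  fix x y
  have "p x / n x - p y / n y = (p x - p y) / n x + p y / n y * ((n y - n x) / n x)"
    using pos[of x] pos[of y] by (simp add: field_simps)
  also have "\<bar>\<dots>\<bar> \<le> \<bar>p x - p y\<bar> / n x + \<bar>p y / n y\<bar> * (\<bar>n y - n x\<bar> / n x)"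
    using pos[of x] abs_triangle_ineq[of "(p x - p y) / n x" "p y / n y * ((n y - n x) / n x)"]
    by (simp add: abs_mult)
  also have "\<dots> \<le> (L * dist x y) / k + B * ((M * dist x y) / k)"
    using lipschitz_onD[OF p, of x y] lipschitz_onD[OF n, of x y] bound[of y] ge[of x] pos[of x]
      \<open>k > 0\<close> \<open>B \<ge> 0\<close> \<open>L \<ge> 0\<close> \<open>M \<ge> 0\<close>
    by (intro add_mono mult_mono frac_le) (auto simp: dist_real_def)
  also have "\<dots> = (L / k + B * M / k) * dist x y"
    by (simp add: field_simps)
  finally show "\<bar>p x / n x - p y / n y\<bar> \<le> (L / k + B * M / k) * dist x y" .
qed

lemma lipschitz_on_snd: "1-lipschitz_on A snd"
  by (rule lipschitz_onI) (use dist_snd_le in \<open>simp_all del: split_paired_All\<close>)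

text \<open>The mutual distance of two bodies whose cube is the denominator in
  \<open>antiprism_f\<close> and \<open>antiprism_g\<close>, with r replaced by max r c. Here s is
  the sine and e = (-1)^k - 1 is 0 or -2. It is the Euclidean norm of a pair of Lipschitz
  coordinates, hence Lipschitz.\<close>

definition clamped_norm :: "real \<Rightarrow> real \<Rightarrow> real \<Rightarrow> real \<times> real \<Rightarrow> real" where
  "clamped_norm c s e z = sqrt ((2 * s * max (fst z) c)\<^sup>2 + (e * snd z)\<^sup>2)"

lemma lipschitz_max_fst: "1-lipschitz_on UNIV (\<lambda>z::real \<times> real. max (fst z) c)"
proof (rule lipschitz_onI)
  fix z w :: "real \<times> real"
  have "\<bar>max (fst z) c - max (fst w) c\<bar> \<le> \<bar>fst z - fst w\<bar>" by linarith
  then show "dist (max (fst z) c) (max (fst w) c) \<le> 1 * dist z w"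
    using dist_fst_le[of z w] by (simp add: dist_real_def)
qed simp

lemma clamped_norm_lipschitz: "(2 * \<bar>s\<bar> + \<bar>e\<bar>)-lipschitz_on UNIV (clamped_norm c s e)"
proof (rule lipschitz_onI)
  fix z w :: "real \<times> real"
  have n: "clamped_norm c s e z = norm (2 * s * max (fst z) c, e * snd z)" for z
    by (simp add: clamped_norm_def norm_Pair)
  have "\<bar>clamped_norm c s e z - clamped_norm c s e w\<bar> \<le>
      norm (2 * s * (max (fst z) c - max (fst w) c), e * (snd z - snd w))"
    unfolding n by (rule order_trans[OF norm_triangle_ineq3]) (simp add: algebra_simps)
  also have "\<dots> \<le> \<bar>2 * s * (max (fst z) c - max (fst w) c)\<bar> + \<bar>e * (snd z - snd w)\<bar>"
    using norm_Pair_le[of "2 * s * (max (fst z) c - max (fst w) c)" "e * (snd z - snd w)"] by simp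
  also have "\<dots> \<le> 2 * \<bar>s\<bar> * dist z w + \<bar>e\<bar> * dist z w"
    using lipschitz_onD[OF lipschitz_max_fst, of z w c] dist_snd_le[of z w]
    unfolding abs_mult by (intro add_mono mult_mono) (auto simp: dist_real_def)
  finally show "dist (clamped_norm c s e z) (clamped_norm c s e w) \<le> (2 * \<bar>s\<bar> + \<bar>e\<bar>) * dist z w"
    by (simp add: dist_real_def algebra_simps)
qed simp

text \<open>The distance dominates each of its two components and is at least 2 * s * c. This tames
  the unbounded numerators max r c and e * d.\<close>

lemma bounded_lipschitz_clamped_norm:
  assumes "s > 0" "c > 0"
  shows "bounded_lipschitz (\<lambda>z. 1 / clamped_norm c s e z)"
    and "bounded_lipschitz (\<lambda>z. max (fst z) c / clamped_norm c s e z)"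
    and "bounded_lipschitz (\<lambda>z. (e * snd z) / clamped_norm c s e z)"
proof -
  have n: "clamped_norm c s e z \<ge> 2 * s * max (fst z) c" "clamped_norm c s e z \<ge> \<bar>e * snd z\<bar>" for z
    unfolding clamped_norm_def by (auto intro!: real_le_rsqrt real_sqrt_ge_abs2)
  have k: "clamped_norm c s e z \<ge> 2 * s * c" for z
    by (rule order_trans[OF mult_left_mono n(1)]) (use assms in auto)
  have pos: "2 * s * c > 0" using assms by simp
  note quot = bounded_lipschitz_quotient[OF _ clamped_norm_lipschitz pos k]
  show "bounded_lipschitz (\<lambda>z. 1 / clamped_norm c s e z)"
    by (rule quot[of 0 _ "1 / (2 * s * c)"]) (use k pos in \<open>auto simp: lipschitz_on_constant field_simps\<close>)
  show "bounded_lipschitz (\<lambda>z. max (fst z) c / clamped_norm c s e z)"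
    by (rule quot[OF lipschitz_max_fst, of _ "1 / (2 * s)"]) (use n(1) assms in \<open>auto simp: field_simps max_def\<close>)
  show "bounded_lipschitz (\<lambda>z. (e * snd z) / clamped_norm c s e z)"
  proof (rule quot[of "\<bar>e\<bar>" _ 1])
    show "\<bar>e\<bar>-lipschitz_on UNIV (\<lambda>z::real \<times> real. e * snd z)"
      using lipschitz_on_cmult_real[OF lipschitz_on_snd[of UNIV], of e] by simp
  qed (use n(2) in auto)
qed

lemma powr_three_halves: "x \<ge> 0 \<Longrightarrow> x powr (3 / 2) = sqrt x ^ 3" for x :: real
  by (cases "x = 0") (auto simp: powr_half_sqrt[symmetric] powr_powr simp flip: powr_realpow)

lemma sin_antiprism_pos:
  assumes "k \<in> {1..2 * N - 1}"
  shows "sin (real k * pi / (2 * real N)) > 0"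
proof (rule sin_gt_zero)
  have k: "k > 0" "k < 2 * N" using assms by auto
  then show "0 < real k * pi / (2 * real N)" by simp
  have "real k < 2 * real N" using k by linarith
  then show "real k * pi / (2 * real N) < pi" using k by (simp add: field_simps)
qed

lemma antiprism_f_clamped:
  "antiprism_f N (max r c) d =
    (\<Sum>k = 1..2 * N - 1. (sin (real k * pi / (2 * real N)))\<^sup>2 /
      clamped_norm c (sin (real k * pi / (2 * real N))) ((-1) ^ k - 1) (r, d) ^ 3)"
  unfolding antiprism_f_def clamped_norm_def
  by (simp add: powr_three_halves power_mult_distrib mult_ac)

lemma antiprism_g_clamped:
  "antiprism_g N (max r c) d =
    (\<Sum>k = 1..2 * N - 1. ((-1) ^ k - 1)\<^sup>2 /
      clamped_norm c (sin (real k * pi / (2 * real N))) ((-1) ^ k - 1) (r, d) ^ 3)"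
  unfolding antiprism_g_def clamped_norm_def
  by (simp add: powr_three_halves power_mult_distrib mult_ac)

text \<open>Every summand has three factors 1 / n, with n the truncated distance. An unbounded r or
  d in front of the sum is absorbed into one of them; in the third claim one of the two factors e of
  e^2 goes along with d.\<close>

lemma bounded_lipschitz_force:
  assumes "c > 0"
  shows "bounded_lipschitz (\<lambda>z. max (fst z) c * antiprism_f N (max (fst z) c) (snd z))"
    and "bounded_lipschitz (\<lambda>z. antiprism_g N (max (fst z) c) (snd z))"
    and "bounded_lipschitz (\<lambda>z. snd z * antiprism_g N (max (fst z) c) (snd z))"
    and "bounded_lipschitz (\<lambda>z::real \<times> real. 1 / max (fst z) c ^ 3)"
proof -
  define s where "s k = sin (real k * pi / (2 * real N))" for k
  define e where "e k = (-1) ^ k - (1::real)" for k :: nat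
  let ?n = "\<lambda>k. clamped_norm c (s k) (e k)"
  have s: "s k > 0" if "k \<in> {1..2 * N - 1}" for k
    unfolding s_def using that by (rule sin_antiprism_pos)
  note bl = bounded_lipschitz_clamped_norm[OF s assms] bounded_lipschitz_mult bounded_lipschitz_const
  have "bounded_lipschitz (\<lambda>z. \<Sum>k = 1..2 * N - 1.
      (s k)\<^sup>2 * ((max (fst z) c / ?n k z) * ((1 / ?n k z) * (1 / ?n k z))))"
    by (intro bounded_lipschitz_sum bl)
  then show "bounded_lipschitz (\<lambda>z. max (fst z) c * antiprism_f N (max (fst z) c) (snd z))"
    by (simp add: antiprism_f_clamped s_def e_def sum_distrib_left power3_eq_cube mult_ac)
  have "bounded_lipschitz (\<lambda>z. \<Sum>k = 1..2 * N - 1.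
      (e k)\<^sup>2 * ((1 / ?n k z) * ((1 / ?n k z) * (1 / ?n k z))))"
    by (intro bounded_lipschitz_sum bl)
  then show "bounded_lipschitz (\<lambda>z. antiprism_g N (max (fst z) c) (snd z))"
    by (simp add: antiprism_g_clamped s_def e_def power3_eq_cube mult_ac)
  have "bounded_lipschitz (\<lambda>z. \<Sum>k = 1..2 * N - 1.
      e k * (((e k * snd z) / ?n k z) * ((1 / ?n k z) * (1 / ?n k z))))"
    by (intro bounded_lipschitz_sum bl)
  then show "bounded_lipschitz (\<lambda>z. snd z * antiprism_g N (max (fst z) c) (snd z))"
    by (simp add: antiprism_g_clamped s_def e_def sum_distrib_left power3_eq_cube power2_eq_square mult_ac)
  have "bounded_lipschitz (\<lambda>z::real \<times> real. 1 / max (fst z) c)"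
    by (rule bounded_lipschitz_quotient[OF _ lipschitz_max_fst assms, where L = 0 and B = "1 / c"])
      (use assms in \<open>auto simp: lipschitz_on_constant field_simps max_def\<close>)
  then have "bounded_lipschitz (\<lambda>z::real \<times> real. (1 / max (fst z) c) * ((1 / max (fst z) c) * (1 / max (fst z) c)))"
    by (intro bounded_lipschitz_mult)
  then show "bounded_lipschitz (\<lambda>z::real \<times> real. 1 / max (fst z) c ^ 3)"
    by (simp add: power3_eq_cube mult_ac)
qed

section \<open>Linearized frequencies\<close>

text \<open>In the plane d = 0 the attraction is an inverse square law, as in the Kepler problem.
  Balancing it against a^2 / r^3 at r0 gives the squared angular momentum m * gamma_N * r0 of the
  circular orbit.\<close>

lemma antiprism_f_zero:
  assumes "r > 0"
  shows "2 * r * m * antiprism_f N r 0 = m * antiprism_gamma N / r\<^sup>2"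
proof -
  have "antiprism_f N r 0 = (\<Sum>k = 1..2 * N - 1. 1 / (8 * r ^ 3) * (1 / sin (real k * pi / (2 * real N))))"
    unfolding antiprism_f_def
  proof (rule sum.cong)
    fix k assume "k \<in> {1..2 * N - 1}"
    then have s: "sin (real k * pi / (2 * real N)) > 0" by (rule sin_antiprism_pos)
    define s where "s = sin (real k * pi / (2 * real N))"
    have "(4 * r\<^sup>2 * s\<^sup>2) powr (3 / 2) = (2 * r * s) ^ 3"
      using s assms by (simp add: powr_three_halves real_sqrt_mult s_def)
    then show "(sin (real k * pi / (2 * real N)))\<^sup>2 /
        (4 * r\<^sup>2 * (sin (real k * pi / (2 * real N)))\<^sup>2 + ((- 1) ^ k - 1)\<^sup>2 * 0\<^sup>2) powr (3 / 2) =
        1 / (8 * r ^ 3) * (1 / sin (real k * pi / (2 * real N)))"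
      using s assms unfolding s_def[symmetric]
      by (simp add: field_simps power2_eq_square power3_eq_cube)
  qed simp
  also have "\<dots> = 1 / (8 * r ^ 3) * (4 * antiprism_gamma N)"
    by (simp only: antiprism_gamma_def sum_distrib_left[symmetric])
  finally show ?thesis
    using assms by (simp add: field_simps power2_eq_square power3_eq_cube)
qed

text \<open>The stiffness of the vertical motion in the plane: at r = r0, multiplied by m / 2, it is
  the squared vertical frequency.\<close>

lemma antiprism_g_zero:
  assumes "r > 0"
  shows "antiprism_g N r 0 = 2 * antiprism_alpha N / r ^ 3"
proof -
  have "antiprism_g N r 0 =
      (\<Sum>k = 1..2 * N - 1. 1 / (8 * r ^ 3) * (((-1) ^ k - 1)\<^sup>2 / sin (real k * pi / (2 * real N)) ^ 3))"
    unfolding antiprism_g_def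
  proof (rule sum.cong)
    fix k assume "k \<in> {1..2 * N - 1}"
    then have s: "sin (real k * pi / (2 * real N)) > 0" by (rule sin_antiprism_pos)
    define s where "s = sin (real k * pi / (2 * real N))"
    have "(4 * r\<^sup>2 * s\<^sup>2) powr (3 / 2) = (2 * r * s) ^ 3"
      using s assms by (simp add: powr_three_halves real_sqrt_mult s_def)
    then show "((-1) ^ k - 1)\<^sup>2 /
        (4 * r\<^sup>2 * (sin (real k * pi / (2 * real N)))\<^sup>2 + ((- 1) ^ k - 1)\<^sup>2 * 0\<^sup>2) powr (3 / 2) =
        1 / (8 * r ^ 3) * (((-1) ^ k - 1)\<^sup>2 / sin (real k * pi / (2 * real N)) ^ 3)"
      using s assms unfolding s_def[symmetric]
      by (simp add: field_simps power_mult_distrib)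
  qed simp
  also have "\<dots> = 1 / (8 * r ^ 3) * (16 * antiprism_alpha N)"
    by (simp only: antiprism_alpha_def sum_distrib_left[symmetric])
  finally show ?thesis
    using assms by simp
qed

text \<open>Needed because alpha_N only sees odd k, where ((-1)^k - 1)^2 = 4, whereas gamma_N sees
  all k. For N = Suc M there are N odd and N - 1 even indices.\<close>

lemma sum_odd_even:
  fixes f :: "nat \<Rightarrow> real"
  shows "(\<Sum>k = 1..2 * Suc M - 1. f k) = (\<Sum>j<Suc M. f (2 * j + 1)) + (\<Sum>j<M. f (2 * j + 2))"
proof (induction M)
  case (Suc M)
  have "(\<Sum>k = 1..2 * Suc (Suc M) - 1. f k) = (\<Sum>k = 1..2 * Suc M - 1. f k) + f (2 * M + 2) + f (2 * M + 3)"
    by (simp add: numeral_2_eq_2 numeral_3_eq_3)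
  then show ?case using Suc by (simp add: numeral_3_eq_3 numeral_2_eq_2)
qed simp

text \<open>Each even summand of \<open>\<gamma>\<^sub>N\<close> is at most the sum of its two odd neighbours, because
  \<open>sin (x - h) + sin (x + h) \<le> 2 * sin x\<close>. This excludes the resonance of the two linearized
  frequencies.\<close>

lemma antiprism_gamma_less:
  assumes "N \<ge> 1"
  shows "0 < antiprism_gamma N" "antiprism_gamma N < 4 * antiprism_alpha N"
proof -
  obtain M where N: "N = Suc M" using assms by (cases N) auto
  define s where "s k = sin (real k * pi / (2 * real N))" for k
  have s: "s k > 0" "s k \<le> 1" if "k \<in> {1..2 * N - 1}" for k
    unfolding s_def using that by (auto intro: sin_antiprism_pos simp: mult.assoc)
  define O1 where "O1 = (\<Sum>j<Suc M. 1 / s (2 * j + 1))"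
  define O3 where "O3 = (\<Sum>j<Suc M. 1 / s (2 * j + 1) ^ 3)"
  have odd: "2 * j + 1 \<in> {1..2 * N - 1}" if "j < Suc M" for j
    using that N by auto
  have "0 < O1" unfolding O1_def
    by (rule sum_pos) (use s odd in \<open>auto simp del: One_nat_def\<close>)
  have "O1 \<le> O3" unfolding O1_def O3_def
  proof (rule sum_mono)
    fix j assume "j \<in> {..<Suc M}"
    then have "s (2 * j + 1) > 0" "s (2 * j + 1) \<le> 1" using s odd by blast+
    then show "1 / s (2 * j + 1) \<le> 1 / s (2 * j + 1) ^ 3"
      by (intro divide_left_mono) (auto intro: power_le_one simp: power3_eq_cube mult_le_one)
  qed
  have mid: "1 / s (2 * j + 2) \<le> 1 / s (2 * j + 1) + 1 / s (2 * (Suc j) + 1)" if "j < M" for j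
  proof -
    have pos: "s (2 * j + 1) > 0" "s (2 * j + 2) > 0" "s (2 * (Suc j) + 1) > 0"
      using that by (auto intro!: s(1) simp: N)
    define h x where "h = pi / (2 * real N)" and "x = real (2 * j + 2) * h"
    have "s (2 * j + 1) = sin (x - h)" "s (2 * (Suc j) + 1) = sin (x + h)" "s (2 * j + 2) = sin x"
      by (auto simp: s_def x_def h_def field_simps add_divide_distrib intro!: arg_cong[of _ _ sin])
    moreover have "sin (x - h) + sin (x + h) = 2 * sin x * cos h"
      by (simp add: sin_add sin_diff)
    ultimately have "s (2 * j + 1) + s (2 * (Suc j) + 1) \<le> 2 * s (2 * j + 2)"
      using pos mult_left_mono[of "cos h" 1 "2 * sin x"] by simp
    then have "s (2 * j + 1) \<le> s (2 * j + 2) \<or> s (2 * (Suc j) + 1) \<le> s (2 * j + 2)"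
      by linarith
    then have "1 / s (2 * j + 2) \<le> 1 / s (2 * j + 1) \<or> 1 / s (2 * j + 2) \<le> 1 / s (2 * (Suc j) + 1)"
      using pos by (auto intro: divide_left_mono)
    moreover have "1 / s (2 * j + 1) > 0" "1 / s (2 * (Suc j) + 1) > 0"
      using pos by simp_all
    ultimately show ?thesis by linarith
  qed
  \<comment> \<open>Each odd index is a neighbour of at most two even ones, so the even part is at
    most 2 * \<open>O1\<close>: the left neighbours omit the last odd index, the right neighbours
    the first.\<close>
  have "(\<Sum>j<M. 1 / s (2 * j + 2)) \<le> (\<Sum>j<M. 1 / s (2 * j + 1)) + (\<Sum>j<M. 1 / s (2 * (Suc j) + 1))"
    unfolding sum.distrib[symmetric] by (rule sum_mono) (use mid in auto)
  also have "(\<Sum>j<M. 1 / s (2 * j + 1)) \<le> O1"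
    using s(1)[OF odd[of M]] by (simp add: O1_def)
  also have "(\<Sum>j<M. 1 / s (2 * (Suc j) + 1)) \<le> O1"
    using s(1)[OF odd[of 0]] by (simp add: O1_def sum.lessThan_Suc_shift del: sum.lessThan_Suc)
  finally have even_le: "(\<Sum>j<M. 1 / s (2 * j + 2)) \<le> 2 * O1" by simp
  have "(\<Sum>j<M. 1 / s (2 * j + 2)) \<ge> 0"
    by (rule sum_nonneg) (use s(1) N in \<open>auto intro: less_imp_le\<close>)
  have gamma: "4 * antiprism_gamma N = O1 + (\<Sum>j<M. 1 / s (2 * j + 2))"
    unfolding antiprism_gamma_def O1_def N using sum_odd_even[of "\<lambda>k. 1 / s k" M]
    by (simp add: s_def N)
  have "16 * antiprism_alpha N = (\<Sum>k = 1..2 * N - 1. ((-1) ^ k - 1)\<^sup>2 / s k ^ 3)"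
    by (simp add: antiprism_alpha_def s_def)
  also have "\<dots> = 4 * O3"
    unfolding N sum_odd_even by (simp add: O3_def sum_distrib_left)
  finally have alpha: "4 * antiprism_alpha N = O3" by simp
  \<comment> \<open>4 * gamma_N \<le> 3 * \<open>O1\<close> < 4 * \<open>O1\<close> \<le> 4 *
    \<open>O3\<close> = 16 * alpha_N.\<close>
  show "0 < antiprism_gamma N" "antiprism_gamma N < 4 * antiprism_alpha N"
    using gamma alpha \<open>O1 > 0\<close> \<open>O1 \<le> O3\<close> even_le \<open>(\<Sum>j<M. 1 / s (2 * j + 2)) \<ge> 0\<close> by linarith+
qed

text \<open>Variation of constants: \<open>E\<close> runs from the velocity of the oscillator with
  constant force k, at s = 0, to v t, at s = t, and its derivative is (h s - k) * cos (\<nu> * (t -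
  s)). Only velocities are estimated, since turning points are zeros of velocities.\<close>

lemma forced_oscillator:
  fixes u v h :: "real \<Rightarrow> real"
  assumes u: "\<And>s. 0 \<le> s \<Longrightarrow> s \<le> t \<Longrightarrow> (u has_real_derivative v s) (at s)"
    and v: "\<And>s. 0 \<le> s \<Longrightarrow> s \<le> t \<Longrightarrow> (v has_real_derivative h s - \<nu>\<^sup>2 * u s) (at s)"
    and h: "\<And>s. 0 \<le> s \<Longrightarrow> s \<le> t \<Longrightarrow> \<bar>h s - k\<bar> \<le> \<epsilon>"
    and "u 0 = 0" "\<nu> > 0" "t \<ge> 0"
  shows "\<bar>v t - (v 0 * cos (\<nu> * t) + k / \<nu> * sin (\<nu> * t))\<bar> \<le> \<epsilon> * t"
proof -
  define E where "E s = v s * cos (\<nu> * (t - s)) - \<nu> * u s * sin (\<nu> * (t - s)) + k / \<nu> * sin (\<nu> * (t - s))" for s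
  have E: "(E has_real_derivative (h s - k) * cos (\<nu> * (t - s))) (at s)" if "0 \<le> s" "s \<le> t" for s
    unfolding E_def using \<open>\<nu> > 0\<close>
    by (auto intro!: derivative_eq_intros u[OF that] v[OF that] simp: field_simps power2_eq_square)
  have "norm (E t - E 0) \<le> \<epsilon> * norm (t - 0)"
  proof (rule field_differentiable_bound[where S = "{0..t}"])
    fix s assume s: "s \<in> {0..t}"
    show "(E has_field_derivative (h s - k) * cos (\<nu> * (t - s))) (at s within {0..t})"
      using E s by (auto intro: has_field_derivative_at_within)
    have "\<bar>h s - k\<bar> * \<bar>cos (\<nu> * (t - s))\<bar> \<le> \<epsilon> * 1"
      using h[of s] s by (intro mult_mono) auto
    then show "norm ((h s - k) * cos (\<nu> * (t - s))) \<le> \<epsilon>" by (simp add: abs_mult)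
  qed (use \<open>t \<ge> 0\<close> in auto)
  then show ?thesis using \<open>u 0 = 0\<close> \<open>t \<ge> 0\<close> by (simp add: E_def)
qed

section \<open>The Poincare-Miranda theorem in the plane\<close>

text \<open>A fixed point of \<open>z \<mapsto> clamp (z + \<Psi> z)\<close> cannot lie on a side of the rectangle where
  \<open>\<Psi>\<close> points inwards.\<close>

lemma poincare_miranda:
  fixes \<phi> \<psi> :: "real \<times> real \<Rightarrow> real"
  assumes "a < b" "c < d"
    and cont: "continuous_on ({a..b} \<times> {c..d}) \<phi>" "continuous_on ({a..b} \<times> {c..d}) \<psi>"
    and \<phi>: "\<And>y. y \<in> {c..d} \<Longrightarrow> \<phi> (a, y) > 0" "\<And>y. y \<in> {c..d} \<Longrightarrow> \<phi> (b, y) < 0"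
    and \<psi>: "\<And>x. x \<in> {a..b} \<Longrightarrow> \<psi> (x, c) > 0" "\<And>x. x \<in> {a..b} \<Longrightarrow> \<psi> (x, d) < 0"
  obtains x y where "x \<in> {a..b}" "y \<in> {c..d}" "\<phi> (x, y) = 0" "\<psi> (x, y) = 0"
proof -
  define S where "S = {a..b} \<times> {c..d}"
  define F where "F z = (max a (min b (fst z + \<phi> z)), max c (min d (snd z + \<psi> z)))" for z
  have "compact S" "convex S" "S \<noteq> {}"
    using assms(1,2) by (auto simp: S_def intro!: compact_Times convex_Times)
  moreover have "continuous_on S F"
    unfolding F_def using cont[folded S_def] by (intro continuous_intros) auto
  moreover have "F \<in> S \<rightarrow> S"
    using assms(1,2) by (auto simp: F_def S_def)
  ultimately obtain z where z: "z \<in> S" "F z = z" by (rule brouwer)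
  obtain x y where xy: "z = (x, y)" by (cases z)
  have x: "x \<in> {a..b}" and y: "y \<in> {c..d}" using z xy by (auto simp: S_def)
  have fix_x: "max a (min b (x + \<phi> (x, y))) = x" and fix_y: "max c (min d (y + \<psi> (x, y))) = y"
    using z xy by (auto simp: F_def)
  have "\<phi> (x, y) = 0"
  proof (rule ccontr)
    assume "\<phi> (x, y) \<noteq> 0"
    then have "x = a \<and> \<phi> (x, y) < 0 \<or> x = b \<and> \<phi> (x, y) > 0"
      using fix_x x \<open>a < b\<close> by (auto simp: max_def min_def split: if_splits)
    then show False using \<phi>[OF y] by auto
  qed
  moreover have "\<psi> (x, y) = 0"
  proof (rule ccontr)
    assume "\<psi> (x, y) \<noteq> 0"
    then have "y = c \<and> \<psi> (x, y) < 0 \<or> y = d \<and> \<psi> (x, y) > 0"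
      using fix_y y \<open>c < d\<close> by (auto simp: max_def min_def split: if_splits)
    then show False using \<psi>[OF x] by auto
  qed
  ultimately show thesis using x y that by blast
qed

section \<open>Reversible second-order systems\<close>

definition newton :: "('a \<Rightarrow> 'a) \<Rightarrow> 'a \<times> 'a \<Rightarrow> 'a \<times> 'a" where
  "newton F x = (snd x, F (fst x))"

lemma newton_lipschitz:
  fixes F :: "'a::metric_space \<Rightarrow> 'a"
  assumes "L-lipschitz_on UNIV F"
  shows "(1 + L)-lipschitz_on UNIV (newton F)"
proof (rule lipschitz_onI)
  show "0 \<le> 1 + L" using lipschitz_on_nonneg[OF assms] by simp
  fix x y :: "'a \<times> 'a"
  have "dist (newton F x) (newton F y) \<le> dist (snd x) (snd y) + dist (F (fst x)) (F (fst y))"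
    by (simp add: newton_def dist_Pair_Pair sqrt_sum_squares_le_sum)
  also have "\<dots> \<le> dist x y + L * dist x y"
    using lipschitz_onD[OF assms, of "fst x" "fst y"] dist_fst_le[of x y] dist_snd_le[of x y]
      lipschitz_on_nonneg[OF assms] mult_left_mono[OF dist_fst_le[of x y], of L]
    by fastforce
  finally show "dist (newton F x) (newton F y) \<le> (1 + L) * dist x y"
    by (simp add: algebra_simps)
qed

text \<open>If \<sigma> commutes with the force, then reversing time and applying \<sigma> to
  positions and -\<sigma> to velocities maps solutions to solutions; the conditions at 0 say that
  the initial state is kept, so uniqueness applies. It is used with the reflection d -> -d at time 0
  and with the identity at a turning point.\<close>

lemma newton_reversal:
  fixes F :: "'a::real_inner \<Rightarrow> 'a"
  assumes lip: "L-lipschitz_on UNIV (newton F)"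
    and x: "\<And>t. (x has_vector_derivative newton F (x t)) (at t)"
    and "bounded_linear \<sigma>" and F: "\<And>z. F (\<sigma> z) = \<sigma> (F z)"
    and init: "\<sigma> (fst (x 0)) = fst (x 0)" "\<sigma> (snd (x 0)) = - snd (x 0)"
  shows "x (- t) = (\<sigma> (fst (x t)), - \<sigma> (snd (x t)))"
proof -
  interpret \<sigma>: bounded_linear \<sigma> by fact
  define y where "y t = (\<sigma> (fst (x (0 - t))), - \<sigma> (snd (x (0 - t))))" for t
  have y: "(y has_vector_derivative newton F (y t)) (at t)" for t
  proof -
    have x': "((\<lambda>t. x (0 - t)) has_vector_derivative - newton F (x (0 - t))) (at t)"
      by (rule has_vector_derivative_mirror_shift) (rule x)
    have "(y has_vector_derivative (\<sigma> (fst (- newton F (x (0 - t)))), - \<sigma> (snd (- newton F (x (0 - t)))))) (at t)"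
      unfolding y_def
      by (intro has_vector_derivative_Pair has_vector_derivative_minus \<sigma>.has_vector_derivative
          bounded_linear.has_vector_derivative[OF bounded_linear_fst]
          bounded_linear.has_vector_derivative[OF bounded_linear_snd] x')
    then show ?thesis by (simp add: newton_def y_def F \<sigma>.neg)
  qed
  have "y 0 = x 0" using init by (simp add: y_def prod_eq_iff)
  with lip y x have "y (- t) = x (- t)"
    by (rule lipschitz_ode_unique)
  then show ?thesis by (simp add: y_def)
qed

section \<open>The truncated equations of motion\<close>

text \<open>The parameter A stands for the squared angular momentum, the only form in which a
  enters. Where r \<ge> c this is the original right-hand side.\<close>

definition antiprism_acc :: "nat \<Rightarrow> real \<Rightarrow> real \<Rightarrow> real \<Rightarrow> real \<times> real \<Rightarrow> real \<times> real" where
  "antiprism_acc N m c A z =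
     (A / max (fst z) c ^ 3 - 2 * max (fst z) c * m * antiprism_f N (max (fst z) c) (snd z),
      - (m * snd z / 2) * antiprism_g N (max (fst z) c) (snd z))"

text \<open>The angular momentum term is linear in A, so the Lipschitz constant can be taken affine
  in |A| with one L for all A.\<close>

lemma antiprism_acc_lipschitz:
  assumes "c > 0"
  obtains L where "\<And>A. (L + \<bar>A\<bar> * L)-lipschitz_on UNIV (newton (antiprism_acc N m c A))"
proof -
  obtain L1 where L1: "L1 > 0" "L1-lipschitz_on UNIV
      (\<lambda>z. max (fst z) c * antiprism_f N (max (fst z) c) (snd z))"
    using bounded_lipschitz_force(1)[OF assms, of N] by (elim bounded_lipschitzE) blast
  obtain L2 where L2: "L2 > 0" "L2-lipschitz_on UNIV
      (\<lambda>z. snd z * antiprism_g N (max (fst z) c) (snd z))"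
    using bounded_lipschitz_force(3)[OF assms, of N] by (elim bounded_lipschitzE) blast
  obtain L3 where L3: "L3 > 0" "L3-lipschitz_on UNIV (\<lambda>z::real \<times> real. 1 / max (fst z) c ^ 3)"
    using bounded_lipschitz_force(4)[OF assms] by (elim bounded_lipschitzE) blast
  define L where "L = 1 + 2 * \<bar>m\<bar> * L1 + \<bar>m\<bar> * L2 + L3"
  have "(L + \<bar>A\<bar> * L)-lipschitz_on UNIV (newton (antiprism_acc N m c A))" for A
  proof (rule lipschitz_on_le[OF newton_lipschitz])
    show "(\<bar>A\<bar> * L3 + 2 * \<bar>m\<bar> * L1 + \<bar>m\<bar> / 2 * L2)-lipschitz_on UNIV (antiprism_acc N m c A)"
    proof (rule lipschitz_onI)
      fix z w :: "real \<times> real"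
      let ?f = "\<lambda>z. max (fst z) c * antiprism_f N (max (fst z) c) (snd z)"
      let ?g = "\<lambda>z. snd z * antiprism_g N (max (fst z) c) (snd z)"
      let ?h = "\<lambda>z::real \<times> real. 1 / max (fst z) c ^ 3"
      have "antiprism_acc N m c A z - antiprism_acc N m c A w =
          (A * (?h z - ?h w) - 2 * m * (?f z - ?f w), - (m / 2) * (?g z - ?g w))"
        by (simp add: antiprism_acc_def algebra_simps diff_divide_distrib)
      then have "dist (antiprism_acc N m c A z) (antiprism_acc N m c A w) \<le>
          norm (A * (?h z - ?h w) - 2 * m * (?f z - ?f w)) + norm (- (m / 2) * (?g z - ?g w))"
        unfolding dist_norm by (simp only: norm_Pair_le)
      also have "\<dots> \<le> \<bar>A\<bar> * \<bar>?h z - ?h w\<bar> + 2 * \<bar>m\<bar> * \<bar>?f z - ?f w\<bar> + \<bar>m\<bar> / 2 * \<bar>?g z - ?g w\<bar>"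
        using abs_triangle_ineq4[of "A * (?h z - ?h w)" "2 * m * (?f z - ?f w)"]
        by (simp add: abs_mult)
      also have "\<dots> \<le> \<bar>A\<bar> * (L3 * dist z w) + 2 * \<bar>m\<bar> * (L1 * dist z w) + \<bar>m\<bar> / 2 * (L2 * dist z w)"
        using lipschitz_onD[OF L1(2), of z w] lipschitz_onD[OF L2(2), of z w] lipschitz_onD[OF L3(2), of z w]
        by (intro add_mono mult_left_mono) (auto simp: dist_real_def)
      finally show "dist (antiprism_acc N m c A z) (antiprism_acc N m c A w) \<le>
          (\<bar>A\<bar> * L3 + 2 * \<bar>m\<bar> * L1 + \<bar>m\<bar> / 2 * L2) * dist z w"
        by (simp add: algebra_simps)
    qed (use L1 L2 L3 in auto)
    have "\<bar>m\<bar> / 2 * L2 \<le> \<bar>m\<bar> * L2" using L2 by simp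
    moreover have "\<bar>A\<bar> * L3 \<le> \<bar>A\<bar> * L" unfolding L_def
      by (rule mult_left_mono) (use L1 L2 L3 in auto)
    ultimately show "1 + (\<bar>A\<bar> * L3 + 2 * \<bar>m\<bar> * L1 + \<bar>m\<bar> / 2 * L2) \<le> L + \<bar>A\<bar> * L"
      unfolding L_def using L1 L2 L3 by linarith
  qed
  then show thesis by (rule that)
qed

section \<open>Uniqueness for the untruncated initial value problem\<close>

lemma has_real_derivative_fst_snd:
  fixes z :: "real \<Rightarrow> real \<times> real"
  assumes "(z has_vector_derivative v) F"
  shows "((\<lambda>t. fst (z t)) has_real_derivative fst v) F" "((\<lambda>t. snd (z t)) has_real_derivative snd v) F"
  using bounded_linear.has_vector_derivative[OF bounded_linear_fst assms]
    bounded_linear.has_vector_derivative[OF bounded_linear_snd assms]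
  by (simp_all add: has_real_derivative_iff_has_vector_derivative)

lemma newton_components:
  fixes x :: "real \<Rightarrow> (real \<times> real) \<times> (real \<times> real)"
  assumes "(x has_vector_derivative newton F (x t)) (at t)"
  shows "((\<lambda>t. fst (fst (x t))) has_real_derivative fst (snd (x t))) (at t)"
    and "((\<lambda>t. snd (fst (x t))) has_real_derivative snd (snd (x t))) (at t)"
    and "((\<lambda>t. fst (snd (x t))) has_real_derivative fst (F (fst (x t)))) (at t)"
    and "((\<lambda>t. snd (snd (x t))) has_real_derivative snd (F (fst (x t)))) (at t)"
proof -
  have "((\<lambda>t. fst (x t)) has_vector_derivative snd (x t)) (at t)"
    "((\<lambda>t. snd (x t)) has_vector_derivative F (fst (x t))) (at t)"
    using bounded_linear.has_vector_derivative[OF bounded_linear_fst assms]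
      bounded_linear.has_vector_derivative[OF bounded_linear_snd assms]
    by (simp_all add: newton_def)
  from has_real_derivative_fst_snd[OF this(1)] has_real_derivative_fst_snd[OF this(2)]
  show "((\<lambda>t. fst (fst (x t))) has_real_derivative fst (snd (x t))) (at t)"
    and "((\<lambda>t. snd (fst (x t))) has_real_derivative snd (snd (x t))) (at t)"
    and "((\<lambda>t. fst (snd (x t))) has_real_derivative fst (F (fst (x t)))) (at t)"
    and "((\<lambda>t. snd (snd (x t))) has_real_derivative snd (F (fst (x t)))) (at t)"
    by auto
qed

text \<open>On the segment between \<open>0\<close> and \<open>t\<close> both solutions stay above some \<open>c > 0\<close>, so there they
  solve the equations with \<open>r\<close> replaced by \<open>max r c\<close>, whose right-hand side is globally Lipschitz.\<close>

lemma ivp_solution_unique: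
  assumes sol: "ivp_solution N m r0 a b J r d" "ivp_solution N m r0 a b J' s e"
    and "t \<in> J" "t \<in> J'"
  shows "r t = s t \<and> d t = e t"
proof -
  let ?C = "closed_segment 0 t"
  have seg: "?C \<subseteq> I" if "ivp_solution N m r0 a b I r d" "t \<in> I" for I r d
  proof -
    have "convex I" "0 \<in> I" using that by (auto simp: ivp_solution_def is_interval_convex)
    then show ?thesis using that(2) by (intro closed_segment_subset) auto
  qed
  have bound: "\<exists>c>0. \<forall>\<tau>\<in>?C. c \<le> r \<tau>" if "ivp_solution N m r0 a b I r d" "t \<in> I" for I r d
  proof -
    have "continuous_on ?C r"
      using that(1) seg[OF that] unfolding ivp_solution_def
      by (meson DERIV_isCont continuous_at_imp_continuous_on subsetD)
    then obtain \<tau> where "\<tau> \<in> ?C" "\<And>u. u \<in> ?C \<Longrightarrow> r \<tau> \<le> r u"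
      using continuous_attains_inf[of ?C r] by auto
    moreover have "r \<tau> > 0" using that(1) seg[OF that] \<open>\<tau> \<in> ?C\<close> by (auto simp: ivp_solution_def)
    ultimately show ?thesis by blast
  qed
  obtain c1 c2 where c1: "c1 > 0" "\<And>\<tau>. \<tau> \<in> ?C \<Longrightarrow> c1 \<le> r \<tau>"
    and c2: "c2 > 0" "\<And>\<tau>. \<tau> \<in> ?C \<Longrightarrow> c2 \<le> s \<tau>"
    using bound[OF sol(1) assms(3)] bound[OF sol(2) assms(4)] by auto
  define c where "c = min c1 c2"
  have "c > 0" using c1 c2 by (simp add: c_def)
  obtain L where lip: "(L + \<bar>a\<^sup>2\<bar> * L)-lipschitz_on UNIV (newton (antiprism_acc N m c (a\<^sup>2)))"
    using antiprism_acc_lipschitz[OF \<open>c > 0\<close>] by blast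
  have trunc: "\<exists>x. (\<forall>\<tau>\<in>?C. (x has_vector_derivative newton (antiprism_acc N m c (a\<^sup>2)) (x \<tau>)) (at \<tau>)) \<and>
      x 0 = ((r0, 0), (0, b)) \<and> fst (x t) = (r t, d t)"
    if sol: "ivp_solution N m r0 a b I r d" and "t \<in> I" and ge: "\<And>\<tau>. \<tau> \<in> ?C \<Longrightarrow> c \<le> r \<tau>" for I r d
  proof -
    obtain r' d' where "\<forall>t\<in>I. (r has_real_derivative r' t) (at t) \<and>
          (d has_real_derivative d' t) (at t) \<and>
          (r' has_real_derivative a\<^sup>2 / (r t) ^ 3 - 2 * r t * m * antiprism_f N (r t) (d t)) (at t) \<and>
          (d' has_real_derivative - (m * d t / 2) * antiprism_g N (r t) (d t)) (at t)"
      and init: "r 0 = r0" "r' 0 = 0" "d 0 = 0" "d' 0 = b"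
      using sol unfolding ivp_solution_def by blast
    then have deriv: "(r has_real_derivative r' t) (at t)" "(d has_real_derivative d' t) (at t)"
        "(r' has_real_derivative a\<^sup>2 / (r t) ^ 3 - 2 * r t * m * antiprism_f N (r t) (d t)) (at t)"
        "(d' has_real_derivative - (m * d t / 2) * antiprism_g N (r t) (d t)) (at t)" if "t \<in> I" for t
      using that by blast+
    define x where "x \<tau> = ((r \<tau>, d \<tau>), (r' \<tau>, d' \<tau>))" for \<tau>
    have "(x has_vector_derivative newton (antiprism_acc N m c (a\<^sup>2)) (x \<tau>)) (at \<tau>)" if \<tau>: "\<tau> \<in> ?C" for \<tau>
    proof -
      have "\<tau> \<in> I" using seg[OF sol \<open>t \<in> I\<close>] \<tau> by blast
      have "newton (antiprism_acc N m c (a\<^sup>2)) (x \<tau>) = ((r' \<tau>, d' \<tau>),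
          (a\<^sup>2 / (r \<tau>) ^ 3 - 2 * r \<tau> * m * antiprism_f N (r \<tau>) (d \<tau>),
           - (m * d \<tau> / 2) * antiprism_g N (r \<tau>) (d \<tau>)))"
        using ge[OF \<tau>] by (simp add: newton_def antiprism_acc_def x_def max_def)
      then show ?thesis unfolding x_def[abs_def]
        using deriv[OF \<open>\<tau> \<in> I\<close>]
        by (auto intro!: has_vector_derivative_Pair simp: has_real_derivative_iff_has_vector_derivative)
    qed
    then show ?thesis using init by (intro exI[of _ x]) (auto simp: x_def)
  qed
  obtain x where x: "\<And>\<tau>. \<tau> \<in> ?C \<Longrightarrow> (x has_vector_derivative newton (antiprism_acc N m c (a\<^sup>2)) (x \<tau>)) (at \<tau>)"
    "x 0 = ((r0, 0), (0, b))" "fst (x t) = (r t, d t)"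
    using trunc[OF sol(1) assms(3)] c1(2) by (force simp: c_def)
  obtain y where y: "\<And>\<tau>. \<tau> \<in> ?C \<Longrightarrow> (y has_vector_derivative newton (antiprism_acc N m c (a\<^sup>2)) (y \<tau>)) (at \<tau>)"
    "y 0 = ((r0, 0), (0, b))" "fst (y t) = (s t, e t)"
    using trunc[OF sol(2) assms(4)] c2(2) by (force simp: c_def)
  have "x t = y t"
    using lip x(1) y(1) by (rule lipschitz_ode_unique) (simp_all only: x(2) y(2))
  then show ?thesis using x(3) y(3) by auto
qed

text \<open>Uniqueness makes the definite descriptions behind \<open>R\<close> and \<open>D\<close>
  well defined, so one global solution determines them at every time.\<close>

lemma R_D_eq_global_solution:
  assumes "ivp_solution N m r0 a b UNIV r d"
  shows "R N m r0 a b = r" "D N m r0 a b = d" "existence_interval N m r0 a b = UNIV"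
proof -
  have "R N m r0 a b t = r t" for t
    unfolding R_def by (rule the_equality) (use assms ivp_solution_unique in blast)+
  then show "R N m r0 a b = r" by blast
  have "D N m r0 a b t = d t" for t
    unfolding D_def by (rule the_equality) (use assms ivp_solution_unique in blast)+
  then show "D N m r0 a b = d" by blast
  show "existence_interval N m r0 a b = UNIV"
    unfolding existence_interval_def using assms by blast
qed

lemma ivp_solutionI:
  assumes "open J" "is_interval J" "0 \<in> J" "\<And>t. t \<in> J \<Longrightarrow> r t > 0"
    and "\<And>t. t \<in> J \<Longrightarrow> (r has_real_derivative r' t) (at t)"
    and "\<And>t. t \<in> J \<Longrightarrow> (d has_real_derivative d' t) (at t)"
    and "\<And>t. t \<in> J \<Longrightarrow>
      (r' has_real_derivative a\<^sup>2 / (r t) ^ 3 - 2 * r t * m * antiprism_f N (r t) (d t)) (at t)"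
    and "\<And>t. t \<in> J \<Longrightarrow> (d' has_real_derivative - (m * d t / 2) * antiprism_g N (r t) (d t)) (at t)"
    and "r 0 = r0" "r' 0 = 0" "d 0 = 0" "d' 0 = b"
  shows "ivp_solution N m r0 a b J r d"
  unfolding ivp_solution_def
proof (intro conjI)
  show "\<forall>t\<in>J. 0 < r t" using assms(4) by blast
qed (rule assms | rule exI[where x = r'], rule exI[where x = d'], intro conjI ballI; rule assms; assumption)+

section \<open>The flow near the circular orbit\<close>

locale antiprism =
  fixes N :: nat and m r0 :: real
  assumes N: "N > 1" and m: "m > 0" and r0: "r0 > 0"
begin

definition A0 :: real where "A0 = m * antiprism_gamma N * r0"
definition \<nu> :: real where "\<nu> = sqrt (m * antiprism_gamma N / r0 ^ 3)"
definition \<omega> :: real where "\<omega> = sqrt (m * antiprism_alpha N / r0 ^ 3)"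

lemma A0_pos: "A0 > 0" and \<nu>_pos: "\<nu> > 0" and \<omega>_pos: "\<omega> > 0" and \<nu>_less: "\<nu> < 2 * \<omega>"
proof -
  have gamma: "antiprism_gamma N > 0" "antiprism_gamma N < 4 * antiprism_alpha N"
    using antiprism_gamma_less[of N] N by auto
  then show "A0 > 0" "\<nu> > 0" "\<omega> > 0"
    using m r0 by (auto simp: A0_def \<nu>_def \<omega>_def)
  have "m * antiprism_gamma N / r0 ^ 3 < 4 * (m * antiprism_alpha N / r0 ^ 3)"
    using gamma m r0 by (simp add: field_simps)
  then have "\<nu> < sqrt (4 * (m * antiprism_alpha N / r0 ^ 3))"
    unfolding \<nu>_def by (rule real_sqrt_less_mono)
  then show "\<nu> < 2 * \<omega>" by (simp only: \<omega>_def real_sqrt_mult real_sqrt_four)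
qed

text \<open>The squared angular momentum is parametrized as \<open>a\<^sup>2 = A0 + \<delta>\<close>, and \<open>r\<close> is truncated
  at \<open>r0 / 2\<close>.\<close>

definition force :: "real \<Rightarrow> real \<times> real \<Rightarrow> real \<times> real" where
  "force \<delta> = antiprism_acc N m (r0 / 2) (A0 + \<delta>)"

lemma half_r0: "r0 / 2 > 0"
  using r0 by simp

text \<open>Bounding |\<delta>| gives one Lipschitz constant for all parameters in play, hence
  estimates of the flow that are uniform in \<delta>.\<close>

lemma force_lipschitz:
  obtains M where "\<And>\<delta>. \<bar>\<delta>\<bar> \<le> 1 \<Longrightarrow> M-lipschitz_on UNIV (newton (force \<delta>))"
proof -
  obtain L where L: "\<And>A. (L + \<bar>A\<bar> * L)-lipschitz_on UNIV (newton (antiprism_acc N m (r0 / 2) A))"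
    using antiprism_acc_lipschitz[OF half_r0] by blast
  have "L \<ge> 0" using lipschitz_on_nonneg[OF L[of 0]] by simp
  have "(L + (A0 + 1) * L)-lipschitz_on UNIV (newton (force \<delta>))" if "\<bar>\<delta>\<bar> \<le> 1" for \<delta>
    unfolding force_def
  proof (rule lipschitz_on_le[OF L])
    show "L + \<bar>A0 + \<delta>\<bar> * L \<le> L + (A0 + 1) * L"
      using that A0_pos \<open>L \<ge> 0\<close> by (intro add_left_mono mult_right_mono) auto
  qed
  then show thesis by (rule that)
qed

text \<open>The state is ((r, d), (r', d')). Since the field is globally Lipschitz, solutions exist
  for all time and are unique, so the choice is determined.\<close>

definition flow :: "real \<Rightarrow> real \<Rightarrow> real \<Rightarrow> (real \<times> real) \<times> (real \<times> real)" where
  "flow \<delta> b = (SOME x. x 0 = ((r0, 0), (0, b)) \<and>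
     (\<forall>t. (x has_vector_derivative newton (force \<delta>) (x t)) (at t)))"

lemma flow_0: "flow \<delta> b 0 = ((r0, 0), (0, b))"
  and flow_deriv: "(flow \<delta> b has_vector_derivative newton (force \<delta>) (flow \<delta> b t)) (at t)"
proof -
  obtain L where "\<And>A. (L + \<bar>A\<bar> * L)-lipschitz_on UNIV (newton (antiprism_acc N m (r0 / 2) A))"
    using antiprism_acc_lipschitz[OF half_r0] by blast
  then have "(L + \<bar>A0 + \<delta>\<bar> * L)-lipschitz_on UNIV (newton (force \<delta>))"
    by (simp add: force_def)
  from lipschitz_ode_exists[OF this, of "((r0, 0), (0, b))"]
  have "\<exists>x. x 0 = ((r0, 0), (0, b)) \<and>
     (\<forall>t. (x has_vector_derivative newton (force \<delta>) (x t)) (at t))" by metis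
  from someI_ex[OF this]
  show "flow \<delta> b 0 = ((r0, 0), (0, b))"
    and "(flow \<delta> b has_vector_derivative newton (force \<delta>) (flow \<delta> b t)) (at t)"
    unfolding flow_def by blast+
qed

abbreviation rad :: "real \<Rightarrow> real \<Rightarrow> real \<Rightarrow> real" where "rad \<delta> b t \<equiv> fst (fst (flow \<delta> b t))"
abbreviation hgt :: "real \<Rightarrow> real \<Rightarrow> real \<Rightarrow> real" where "hgt \<delta> b t \<equiv> snd (fst (flow \<delta> b t))"
abbreviation rad' :: "real \<Rightarrow> real \<Rightarrow> real \<Rightarrow> real" where "rad' \<delta> b t \<equiv> fst (snd (flow \<delta> b t))"
abbreviation hgt' :: "real \<Rightarrow> real \<Rightarrow> real \<Rightarrow> real" where "hgt' \<delta> b t \<equiv> snd (snd (flow \<delta> b t))"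

lemmas flow_components = newton_components[OF flow_deriv]

text \<open>At \<delta> = 0 the centrifugal term cancels the attraction at (r0, 0). This circular
  orbit is the base point of the perturbation estimates and the solution for b = 0.\<close>

lemma flow_equilibrium: "flow 0 0 t = ((r0, 0), (0, 0))"
proof -
  have "A0 / r0 ^ 3 = m * antiprism_gamma N / r0\<^sup>2"
    using r0 by (simp add: A0_def power2_eq_square power3_eq_cube)
  then have "force 0 (r0, 0) = (0, 0)"
    using r0 antiprism_f_zero[of r0 m N] by (simp add: force_def antiprism_acc_def max_def)
  then have *: "((\<lambda>_. ((r0, 0), (0, 0))) has_vector_derivative newton (force 0) ((r0, 0), (0, 0))) (at s)" for s
    by (simp add: newton_def zero_prod_def[symmetric])
  obtain M where M: "\<And>\<delta>. \<bar>\<delta>\<bar> \<le> 1 \<Longrightarrow> M-lipschitz_on UNIV (newton (force \<delta>))"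
    by (rule force_lipschitz) blast
  have "M-lipschitz_on UNIV (newton (force 0))" by (rule M) simp
  from lipschitz_ode_unique[OF this flow_deriv *] show ?thesis
    by (simp add: flow_0)
qed

text \<open>A solution for \<delta>' is an approximate solution for \<delta>: the fields differ only
  by (\<delta> - \<delta>') / (max r (r0 / 2))^3, which is at most 8 / r0^3 times |\<delta> -
  \<delta>'|.\<close>

lemma flow_lipschitz:
  obtains C where "C > 0" "\<And>\<delta> \<delta>' b b' t. \<bar>\<delta>\<bar> \<le> 1 \<Longrightarrow> \<bar>\<delta>'\<bar> \<le> 1 \<Longrightarrow> 0 \<le> t \<Longrightarrow> t \<le> S \<Longrightarrow>
    norm (flow \<delta> b t - flow \<delta>' b' t) \<le> C * (\<bar>\<delta> - \<delta>'\<bar> + \<bar>b - b'\<bar>)"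
proof -
  obtain M where M: "\<And>\<delta>. \<bar>\<delta>\<bar> \<le> 1 \<Longrightarrow> M-lipschitz_on UNIV (newton (force \<delta>))"
    by (rule force_lipschitz) blast
  have "M \<ge> 0" using lipschitz_on_nonneg[OF M[of 0]] by simp
  define E where "E = exp ((2 * M + 1) * S)"
  define C where "C = (1 + 8 / r0 ^ 3) * E"
  have "C > 0" using r0 by (auto simp: C_def E_def intro!: mult_pos_pos add_pos_pos)
  moreover have "norm (flow \<delta> b t - flow \<delta>' b' t) \<le> C * (\<bar>\<delta> - \<delta>'\<bar> + \<bar>b - b'\<bar>)"
    if "\<bar>\<delta>\<bar> \<le> 1" "\<bar>\<delta>'\<bar> \<le> 1" "0 \<le> t" "t \<le> S" for \<delta> \<delta>' b b' t
  proof -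
    let ?s = "\<bar>\<delta> - \<delta>'\<bar> + \<bar>b - b'\<bar>"
    have err: "norm (newton (force \<delta>) y - newton (force \<delta>') y) \<le> \<bar>\<delta> - \<delta>'\<bar> * (8 / r0 ^ 3)" for y
    proof -
      let ?R = "max (fst (fst y)) (r0 / 2)"
      have "newton (force \<delta>) y - newton (force \<delta>') y = (0, ((\<delta> - \<delta>') * (1 / ?R ^ 3), 0))"
        by (simp add: newton_def force_def antiprism_acc_def diff_divide_distrib add_divide_distrib zero_prod_def)
      then have "norm (newton (force \<delta>) y - newton (force \<delta>') y) = \<bar>\<delta> - \<delta>'\<bar> * (1 / ?R ^ 3)"
        using r0 by (simp add: norm_Pair abs_mult)
      also have "1 / ?R ^ 3 \<le> 1 / (r0 / 2) ^ 3"
        using r0 by (intro divide_left_mono power_mono mult_pos_pos) auto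
      also have "1 / (r0 / 2) ^ 3 = 8 / r0 ^ 3"
        by (simp add: power_divide)
      finally show ?thesis by (simp add: mult_left_mono)
    qed
    have "(norm (flow \<delta> b t - flow \<delta>' b' t))\<^sup>2 \<le>
        ((norm (flow \<delta> b 0 - flow \<delta>' b' 0))\<^sup>2 + (\<bar>\<delta> - \<delta>'\<bar> * (8 / r0 ^ 3))\<^sup>2) * exp ((2 * M + 1) * t)"
      by (rule approximate_solution_dist[OF M[OF that(1)] flow_deriv flow_deriv err that(3,4)])
    also have "norm (flow \<delta> b 0 - flow \<delta>' b' 0) = \<bar>b - b'\<bar>"
      by (simp add: flow_0 norm_Pair)
    \<comment> \<open>Both factors are enlarged to squares, using E \<ge> 1, so that the root can be
      taken.\<close>
    also have "(\<bar>b - b'\<bar>\<^sup>2 + (\<bar>\<delta> - \<delta>'\<bar> * (8 / r0 ^ 3))\<^sup>2) * exp ((2 * M + 1) * t) \<le>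
        ((1 + 8 / r0 ^ 3) * ?s)\<^sup>2 * E\<^sup>2"
    proof (rule mult_mono)
      have "\<bar>b - b'\<bar>\<^sup>2 + (\<bar>\<delta> - \<delta>'\<bar> * (8 / r0 ^ 3))\<^sup>2 \<le> (\<bar>b - b'\<bar> + \<bar>\<delta> - \<delta>'\<bar> * (8 / r0 ^ 3))\<^sup>2"
        using r0 by (simp add: power2_sum)
      also have "\<dots> \<le> ((1 + 8 / r0 ^ 3) * ?s)\<^sup>2"
      proof (intro power_mono)
        have *: "x + y * k \<le> (1 + k) * (y + x)" if "x \<ge> 0" "y \<ge> 0" "k \<ge> 0" for x y k :: real
          using that by (simp add: algebra_simps)
        show "\<bar>b - b'\<bar> + \<bar>\<delta> - \<delta>'\<bar> * (8 / r0 ^ 3) \<le> (1 + 8 / r0 ^ 3) * ?s"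
          using r0 by (intro *) auto
      qed (use r0 in auto)
      finally show "\<bar>b - b'\<bar>\<^sup>2 + (\<bar>\<delta> - \<delta>'\<bar> * (8 / r0 ^ 3))\<^sup>2 \<le> ((1 + 8 / r0 ^ 3) * ?s)\<^sup>2" .
      have "exp ((2 * M + 1) * t) \<le> E"
        unfolding E_def using that \<open>M \<ge> 0\<close> by (simp add: mult_left_mono)
      moreover have "E \<ge> 1"
        unfolding E_def using that \<open>M \<ge> 0\<close> by simp
      ultimately show "exp ((2 * M + 1) * t) \<le> E\<^sup>2"
        using self_le_power[of E 2] by simp
    qed auto
    also have "\<dots> = (C * ?s)\<^sup>2"
      by (simp add: C_def power_mult_distrib)
    finally show ?thesis
      by (rule power2_le_imp_le) (use \<open>C > 0\<close> in simp)
  qed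
  ultimately show thesis by (rule that)
qed

text \<open>The vertical equation is linear in d with a bounded coefficient, so d scales with its
  initial velocity b whatever the radius does. General Lipschitz dependence would only give
  |\<delta>| + |b|, too weak for the later division by b.\<close>

lemma hgt_bound:
  obtains C where "C > 0" "\<And>\<delta> b t. 0 \<le> t \<Longrightarrow> t \<le> S \<Longrightarrow> \<bar>hgt \<delta> b t\<bar> \<le> C * \<bar>b\<bar>"
proof -
  let ?g = "\<lambda>z. antiprism_g N (max (fst z) (r0 / 2)) (snd z)"
  obtain B where B: "B > 0" "\<And>z. \<bar>?g z\<bar> \<le> B"
    using bounded_lipschitz_force(2)[OF half_r0, of N] by (elim bounded_lipschitzE) blast
  \<comment> \<open>Bounds |1 - G|, where G is the coefficient of the vertical equation; the
    derivative of p^2 + q^2 is 2 * p * q * (1 - G).\<close>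
  define K where "K = 1 + m / 2 * B"
  have "K \<ge> 1" using m B by (simp add: K_def)
  have "\<bar>hgt \<delta> b t\<bar> \<le> exp (K * S) * \<bar>b\<bar>" if t: "0 \<le> t" "t \<le> S" for \<delta> b t
  proof -
    define p q where "p = hgt \<delta> b" and "q = hgt' \<delta> b"
    define G where "G s = m / 2 * ?g (fst (flow \<delta> b s))" for s
    have p: "(p has_real_derivative q s) (at s)" and q: "(q has_real_derivative - G s * p s) (at s)" for s
      using flow_components(2,4)[of \<delta> b s]
      by (simp_all add: p_def[abs_def] q_def[abs_def] G_def force_def antiprism_acc_def mult_ac)
    have "(p t)\<^sup>2 + (q t)\<^sup>2 \<le> ((p 0)\<^sup>2 + (q 0)\<^sup>2 + 0) * exp (K * t)"
    proof (rule gronwall_exp_bound[where S = S])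
      fix s
      show "((\<lambda>s. (p s)\<^sup>2 + (q s)\<^sup>2) has_real_derivative 2 * p s * q s * (1 - G s)) (at s)"
        by (auto intro!: derivative_eq_intros p q simp: algebra_simps)
      have G: "\<bar>1 - G s\<bar> \<le> K"
      proof -
        have "\<bar>G s\<bar> \<le> m / 2 * B"
          using B(2)[of "fst (flow \<delta> b s)"] m by (simp add: G_def abs_mult)
        then show ?thesis unfolding K_def by linarith
      qed
      have "2 * p s * q s * (1 - G s) \<le> \<bar>2 * p s * q s\<bar> * \<bar>1 - G s\<bar>"
        by (metis abs_ge_self abs_mult)
      also have "\<dots> \<le> ((p s)\<^sup>2 + (q s)\<^sup>2) * K"
        using G sum_squares_bound[of "\<bar>p s\<bar>" "\<bar>q s\<bar>"]
        by (intro mult_mono) (auto simp: abs_mult)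
      finally show "2 * p s * q s * (1 - G s) \<le> K * ((p s)\<^sup>2 + (q s)\<^sup>2) + 0"
        by (simp add: mult.commute)
    qed (use \<open>K \<ge> 1\<close> t in auto)
    then have *: "(p t)\<^sup>2 + (q t)\<^sup>2 \<le> b\<^sup>2 * exp (K * t)"
      by (simp add: p_def q_def flow_0)
    have "(p t)\<^sup>2 \<le> b\<^sup>2 * exp (K * t)"
      by (rule order_trans[OF _ *]) simp
    also have "\<dots> \<le> b\<^sup>2 * (exp (K * S))\<^sup>2"
    proof (rule mult_left_mono)
      have "exp (K * t) \<le> exp (K * S)" using \<open>K \<ge> 1\<close> t by simp
      also have "\<dots> \<le> (exp (K * S))\<^sup>2"
        using \<open>K \<ge> 1\<close> t by (intro self_le_power) auto
      finally show "exp (K * t) \<le> (exp (K * S))\<^sup>2" .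
    qed simp
    also have "\<dots> = (exp (K * S) * \<bar>b\<bar>)\<^sup>2" by (simp add: power_mult_distrib)
    finally show ?thesis
      unfolding p_def using abs_le_square_iff[of "hgt \<delta> b t" "exp (K * S) * \<bar>b\<bar>"] by (simp add: abs_mult)
  qed
  then show thesis by (intro that[of "exp (K * S)"]) auto
qed

text \<open>To first order, \<open>\<delta>\<close> shifts the centre of the radial oscillation and \<open>b\<close> is the amplitude of the
  vertical one.\<close>

lemma flow_asymptotics:
  assumes "S > 0"
  obtains C where "C > 0"
    "\<And>\<delta> b t. \<bar>\<delta>\<bar> \<le> 1 \<Longrightarrow> C * (\<bar>\<delta>\<bar> + \<bar>b\<bar>) \<le> r0 \<Longrightarrow> 0 \<le> t \<Longrightarrow> t \<le> S \<Longrightarrow>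
      r0 / 2 \<le> rad \<delta> b t \<and>
      \<bar>rad' \<delta> b t - \<delta> / (r0 ^ 3 * \<nu>) * sin (\<nu> * t)\<bar> \<le> C * ((\<bar>\<delta>\<bar> + \<bar>b\<bar>)\<^sup>2 + \<bar>b\<bar>) \<and>
      \<bar>hgt' \<delta> b t - b * cos (\<omega> * t)\<bar> \<le> C * (\<bar>\<delta>\<bar> + \<bar>b\<bar>) * \<bar>b\<bar>"
proof -
  let ?R = "\<lambda>z::real \<times> real. max (fst z) (r0 / 2)"
  let ?f = "\<lambda>z. ?R z * antiprism_f N (?R z) (snd z)"
  let ?g = "\<lambda>z. antiprism_g N (?R z) (snd z)"
  let ?h = "\<lambda>z. 1 / ?R z ^ 3"
  obtain Lf where Lf: "Lf > 0" "\<And>z w. \<bar>?f z - ?f w\<bar> \<le> Lf * dist z w"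
    using bounded_lipschitz_force(1)[OF half_r0, of N] by (elim bounded_lipschitzE) blast
  obtain Lg where Lg: "Lg > 0" "\<And>z w. \<bar>?g z - ?g w\<bar> \<le> Lg * dist z w"
    using bounded_lipschitz_force(2)[OF half_r0, of N] by (elim bounded_lipschitzE) blast
  obtain Lh where Lh: "Lh > 0" "\<And>z w. \<bar>?h z - ?h w\<bar> \<le> Lh * dist z w"
    using bounded_lipschitz_force(4)[OF half_r0] by (elim bounded_lipschitzE) blast
  obtain C1 where C1: "C1 > 0" "\<And>\<delta> \<delta>' b b' t. \<bar>\<delta>\<bar> \<le> 1 \<Longrightarrow> \<bar>\<delta>'\<bar> \<le> 1 \<Longrightarrow> 0 \<le> t \<Longrightarrow> t \<le> S \<Longrightarrow>
    norm (flow \<delta> b t - flow \<delta>' b' t) \<le> C1 * (\<bar>\<delta> - \<delta>'\<bar> + \<bar>b - b'\<bar>)"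
    by (rule flow_lipschitz) blast
  obtain C2 where C2: "C2 > 0" "\<And>\<delta> b t. 0 \<le> t \<Longrightarrow> t \<le> S \<Longrightarrow> \<bar>hgt \<delta> b t\<bar> \<le> C2 * \<bar>b\<bar>"
    by (rule hgt_bound) blast
  \<comment> \<open>\<open>K1\<close> measures the product of two first-order radial deviations,
    \<open>K2\<close> the effect of the height on the radial force, \<open>K3\<close> the change of
    the vertical stiffness multiplied by the height.\<close>
  define K1 where "K1 = (1 + A0 / r0 * C1) * (Lh * C1)"
  define K2 where "K2 = 2 * m * (Lf * C2)"
  define K3 where "K3 = m / 2 * (Lg * C1) * C2"
  have K: "K1 > 0" "K2 > 0" "K3 > 0"
    using A0_pos r0 m C1(1) C2(1) Lf(1) Lg(1) Lh(1)
    by (auto simp: K1_def K2_def K3_def intro!: mult_pos_pos add_pos_pos divide_pos_pos)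
  \<comment> \<open>The part 2 * \<open>C1\<close> keeps r within r0 / 2 of r0 when C * (|\<delta>|
    + |b|) \<le> r0; the rest bounds the force errors accumulated up to time S.\<close>
  define C where "C = 2 * C1 + (K1 + K2) * S + K3 * S"
  have S: "K1 * S > 0" "K2 * S > 0" "K3 * S > 0" using K \<open>S > 0\<close> by simp_all
  then have C: "C > 0" "2 * C1 \<le> C" "(K1 + K2) * S \<le> C" "K3 * S \<le> C"
    using C1(1) unfolding C_def distrib_right by linarith+
  have A0_\<nu>: "\<nu>\<^sup>2 = A0 / r0 ^ 4" "m * antiprism_gamma N = A0 / r0"
    using A0_pos r0 antiprism_gamma_less(1)[of N] N m
    by (auto simp: A0_def \<nu>_def power_numeral_reduce)
  have g_\<omega>: "\<omega>\<^sup>2 = m / 2 * antiprism_g N r0 0"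
    using antiprism_g_zero[of r0 N] antiprism_gamma_less[of N] N m r0 by (simp add: \<omega>_def)
  have main: "r0 / 2 \<le> rad \<delta> b t \<and>
      \<bar>rad' \<delta> b t - \<delta> / (r0 ^ 3 * \<nu>) * sin (\<nu> * t)\<bar> \<le> C * ((\<bar>\<delta>\<bar> + \<bar>b\<bar>)\<^sup>2 + \<bar>b\<bar>) \<and>
      \<bar>hgt' \<delta> b t - b * cos (\<omega> * t)\<bar> \<le> C * (\<bar>\<delta>\<bar> + \<bar>b\<bar>) * \<bar>b\<bar>"
    if \<delta>: "\<bar>\<delta>\<bar> \<le> 1" and small: "C * (\<bar>\<delta>\<bar> + \<bar>b\<bar>) \<le> r0" and t: "0 \<le> t" "t \<le> S" for \<delta> b t
  proof -
    define s where "s = \<bar>\<delta>\<bar> + \<bar>b\<bar>"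
    have "s \<ge> 0" "\<bar>\<delta>\<bar> \<le> s" by (auto simp: s_def)
    define z where "z \<tau> = fst (flow \<delta> b \<tau>)" for \<tau>
    have near: "dist (z \<tau>) (r0, 0) \<le> C1 * s" if "0 \<le> \<tau>" "\<tau> \<le> S" for \<tau>
      using C1(2)[OF \<delta> _ that, of 0 b 0] norm_fst_le[of "fst (flow \<delta> b \<tau>) - (r0, 0)" "snd (flow \<delta> b \<tau>) - (0, 0)"]
      by (simp add: flow_equilibrium z_def s_def dist_norm minus_prod_def)
    have rad_near: "\<bar>fst (z \<tau>) - r0\<bar> \<le> C1 * s" if "0 \<le> \<tau>" "\<tau> \<le> S" for \<tau>
      using near[OF that] dist_fst_le[of "z \<tau>" "(r0, 0)"] by (simp add: dist_real_def)
    have "2 * C1 * s \<le> C * s" using C(2) \<open>s \<ge> 0\<close> by (rule mult_right_mono)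
    then have "C1 * s \<le> r0 / 2" using small by (simp add: s_def)
    then have rad_ge: "r0 / 2 \<le> fst (z \<tau>)" if "0 \<le> \<tau>" "\<tau> \<le> S" for \<tau>
      using rad_near[OF that] by linarith
    have hgt_le: "\<bar>snd (z \<tau>)\<bar> \<le> C2 * \<bar>b\<bar>" if "0 \<le> \<tau>" "\<tau> \<le> S" for \<tau>
      using C2(2)[OF that] by (simp add: z_def)
    have radial: "\<bar>(fst (force \<delta> (z \<tau>)) + \<nu>\<^sup>2 * (fst (z \<tau>) - r0)) - \<delta> / r0 ^ 3\<bar> \<le> K1 * s\<^sup>2 + K2 * \<bar>b\<bar>"
      if \<tau>: "0 \<le> \<tau>" "\<tau> \<le> S" for \<tau>
    proof -
      define u where "u = fst (z \<tau>) - r0"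
      have R: "fst (z \<tau>) = r0 + u" "r0 / 2 \<le> r0 + u" "r0 + u > 0"
        using rad_ge[OF \<tau>] r0 by (auto simp: u_def)
      have u: "\<bar>u\<bar> \<le> C1 * s" using rad_near[OF \<tau>] by (simp add: u_def)
      \<comment> \<open>The point is first projected to the plane d = 0, where the force is
        explicit. The projection costs a multiple of |d|, hence of |b|.\<close>
      have "fst (force \<delta> (z \<tau>)) = (A0 + \<delta>) / (r0 + u) ^ 3 - 2 * m * ?f (r0 + u, 0)
          - 2 * m * (?f (z \<tau>) - ?f (r0 + u, 0))"
        using R by (simp add: force_def antiprism_acc_def max_absorb1 algebra_simps)
      also have "2 * m * ?f (r0 + u, 0) = A0 / (r0 * (r0 + u)\<^sup>2)"
      proof -
        have "2 * m * ?f (r0 + u, 0) = 2 * (r0 + u) * m * antiprism_f N (r0 + u) 0"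
          using R by (simp add: max_absorb1)
        also have "\<dots> = A0 / (r0 * (r0 + u)\<^sup>2)"
          using antiprism_f_zero[OF R(3), of m N] A0_\<nu>(2) by simp
        finally show ?thesis .
      qed
      \<comment> \<open>The linear terms are split off exactly, with \<nu>^2 = A0 / r0^4. What
        remains is a product of two factors, each of first order in |\<delta>| + |b|.\<close>
      also have "(A0 + \<delta>) / (r0 + u) ^ 3 - A0 / (r0 * (r0 + u)\<^sup>2) =
          (\<delta> - A0 / r0 * u) * (1 / (r0 + u) ^ 3 - 1 / r0 ^ 3) + \<delta> / r0 ^ 3 - \<nu>\<^sup>2 * u"
      proof -
        have "A0 / (r0 * (r0 + u)\<^sup>2) = A0 * (1 / (r0 + u) ^ 3) + A0 / r0 * u * (1 / (r0 + u) ^ 3)"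
          using r0 R(3) by (simp add: divide_simps) (simp add: algebra_simps power2_eq_square power3_eq_cube)
        moreover have "\<nu>\<^sup>2 * u = A0 / r0 * u * (1 / r0 ^ 3)"
          unfolding A0_\<nu>(1) by (simp add: power_numeral_reduce)
        ultimately show ?thesis by (simp add: left_diff_distrib right_diff_distrib add_divide_distrib diff_divide_distrib)
      qed
      finally have eq: "(fst (force \<delta> (z \<tau>)) + \<nu>\<^sup>2 * u) - \<delta> / r0 ^ 3 =
          (\<delta> - A0 / r0 * u) * (?h (r0 + u, 0) - ?h (r0, 0)) - 2 * m * (?f (z \<tau>) - ?f (r0 + u, 0))"
        using R r0 by (simp add: max_absorb1)
      have "\<bar>(fst (force \<delta> (z \<tau>)) + \<nu>\<^sup>2 * u) - \<delta> / r0 ^ 3\<bar> \<le>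
          \<bar>\<delta> - A0 / r0 * u\<bar> * \<bar>?h (r0 + u, 0) - ?h (r0, 0)\<bar> + 2 * m * \<bar>?f (z \<tau>) - ?f (r0 + u, 0)\<bar>"
        unfolding eq using m abs_triangle_ineq4[of "(\<delta> - A0 / r0 * u) * (?h (r0 + u, 0) - ?h (r0, 0))" "2 * m * (?f (z \<tau>) - ?f (r0 + u, 0))"]
        by (simp add: abs_mult)
      also have "\<dots> \<le> ((1 + A0 / r0 * C1) * s) * (Lh * (C1 * s)) + 2 * m * (Lf * (C2 * \<bar>b\<bar>))"
      proof (intro add_mono mult_mono mult_left_mono)
        have "\<bar>\<delta> - A0 / r0 * u\<bar> \<le> \<bar>\<delta>\<bar> + A0 / r0 * \<bar>u\<bar>"
          using abs_triangle_ineq4[of \<delta> "A0 / r0 * u"] A0_pos r0 by (simp add: abs_mult)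
        also have "\<dots> \<le> s + A0 / r0 * (C1 * s)"
          using \<open>\<bar>\<delta>\<bar> \<le> s\<close> u A0_pos r0 by (intro add_mono mult_left_mono) auto
        finally show "\<bar>\<delta> - A0 / r0 * u\<bar> \<le> (1 + A0 / r0 * C1) * s"
          by (simp add: algebra_simps)
        have "\<bar>?h (r0 + u, 0) - ?h (r0, 0)\<bar> \<le> Lh * dist (r0 + u, 0::real) (r0, 0)" by (rule Lh)
        also have "\<dots> \<le> Lh * (C1 * s)"
          using Lh(1) u by (intro mult_left_mono) (auto simp: dist_Pair_Pair dist_real_def)
        finally show "\<bar>?h (r0 + u, 0) - ?h (r0, 0)\<bar> \<le> Lh * (C1 * s)" .
        have "\<bar>?f (z \<tau>) - ?f (r0 + u, 0)\<bar> \<le> Lf * dist (z \<tau>) (r0 + u, 0)" by (rule Lf)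
        also have "dist (z \<tau>) (r0 + u, 0) = \<bar>snd (z \<tau>)\<bar>"
          by (cases "z \<tau>") (simp add: dist_Pair_Pair dist_real_def u_def)
        also have "Lf * \<bar>snd (z \<tau>)\<bar> \<le> Lf * (C2 * \<bar>b\<bar>)"
          using Lf(1) hgt_le[OF \<tau>] by (intro mult_left_mono) auto
        finally show "\<bar>?f (z \<tau>) - ?f (r0 + u, 0)\<bar> \<le> Lf * (C2 * \<bar>b\<bar>)" .
      qed (use A0_pos r0 C1(1) \<open>s \<ge> 0\<close> m in auto)
      also have "\<dots> = K1 * s\<^sup>2 + K2 * \<bar>b\<bar>"
        by (simp add: K1_def K2_def power2_eq_square)
      finally show ?thesis by (simp add: u_def)
    qed
    have "\<bar>rad' \<delta> b t - (rad' \<delta> b 0 * cos (\<nu> * t) + (\<delta> / r0 ^ 3) / \<nu> * sin (\<nu> * t))\<bar> \<le> (K1 * s\<^sup>2 + K2 * \<bar>b\<bar>) * t"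
    proof (rule forced_oscillator[where u = "\<lambda>\<tau>. rad \<delta> b \<tau> - r0" and
          h = "\<lambda>\<tau>. fst (force \<delta> (z \<tau>)) + \<nu>\<^sup>2 * (fst (z \<tau>) - r0)"])
      fix \<tau> assume \<tau>: "0 \<le> \<tau>" "\<tau> \<le> t"
      show "((\<lambda>\<tau>. rad \<delta> b \<tau> - r0) has_real_derivative rad' \<delta> b \<tau>) (at \<tau>)"
        using flow_components(1) by (auto intro!: derivative_eq_intros)
      show "(rad' \<delta> b has_real_derivative
          fst (force \<delta> (z \<tau>)) + \<nu>\<^sup>2 * (fst (z \<tau>) - r0) - \<nu>\<^sup>2 * (rad \<delta> b \<tau> - r0)) (at \<tau>)"
        using flow_components(3)[of \<delta> b \<tau>] by (simp add: z_def)
      show "\<bar>fst (force \<delta> (z \<tau>)) + \<nu>\<^sup>2 * (fst (z \<tau>) - r0) - \<delta> / r0 ^ 3\<bar> \<le> K1 * s\<^sup>2 + K2 * \<bar>b\<bar>"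
        using radial \<tau> t by simp
    qed (use \<nu>_pos t flow_0 in auto)
    also have "\<dots> \<le> (K1 * s\<^sup>2 + K2 * \<bar>b\<bar>) * S"
      using K t by (intro mult_left_mono) auto
    also have "\<dots> \<le> C * (s\<^sup>2 + \<bar>b\<bar>)"
    proof -
      have "(K1 * s\<^sup>2 + K2 * \<bar>b\<bar>) * S \<le> ((K1 + K2) * S) * (s\<^sup>2 + \<bar>b\<bar>)"
      proof -
        have "0 \<le> K1 * (S * \<bar>b\<bar>)" "0 \<le> K2 * (S * s\<^sup>2)" using K \<open>S > 0\<close> by simp_all
        then show ?thesis by (simp add: algebra_simps)
      qed
      also have "\<dots> \<le> C * (s\<^sup>2 + \<bar>b\<bar>)" using C(3) by (intro mult_right_mono) auto
      finally show ?thesis .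
    qed
    finally have rad': "\<bar>rad' \<delta> b t - \<delta> / (r0 ^ 3 * \<nu>) * sin (\<nu> * t)\<bar> \<le> C * (s\<^sup>2 + \<bar>b\<bar>)"
      by (simp add: flow_0)
    have vertical: "\<bar>(snd (force \<delta> (z \<tau>)) + \<omega>\<^sup>2 * snd (z \<tau>)) - 0\<bar> \<le> K3 * s * \<bar>b\<bar>"
      if \<tau>: "0 \<le> \<tau>" "\<tau> \<le> S" for \<tau>
    proof -
      \<comment> \<open>Freezing the stiffness at (r0, 0) leaves an error that is a multiple of d
        itself and so keeps a factor |b|.\<close>
      have "snd (force \<delta> (z \<tau>)) + \<omega>\<^sup>2 * snd (z \<tau>) = - (m / 2) * (?g (z \<tau>) - ?g (r0, 0)) * snd (z \<tau>)"
        unfolding g_\<omega> using r0 by (simp add: force_def antiprism_acc_def max_def algebra_simps)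
      then have "\<bar>(snd (force \<delta> (z \<tau>)) + \<omega>\<^sup>2 * snd (z \<tau>)) - 0\<bar> =
          m / 2 * \<bar>?g (z \<tau>) - ?g (r0, 0)\<bar> * \<bar>snd (z \<tau>)\<bar>"
        using m by (simp add: abs_mult)
      also have "\<dots> \<le> m / 2 * (Lg * (C1 * s)) * (C2 * \<bar>b\<bar>)"
      proof (intro mult_mono mult_left_mono)
        have "\<bar>?g (z \<tau>) - ?g (r0, 0)\<bar> \<le> Lg * dist (z \<tau>) (r0, 0)" by (rule Lg)
        also have "\<dots> \<le> Lg * (C1 * s)" using Lg(1) near[OF \<tau>] by simp
        finally show "\<bar>?g (z \<tau>) - ?g (r0, 0)\<bar> \<le> Lg * (C1 * s)" .
        show "\<bar>snd (z \<tau>)\<bar> \<le> C2 * \<bar>b\<bar>" by (rule hgt_le[OF \<tau>])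
      qed (use m Lg(1) C1(1) \<open>s \<ge> 0\<close> in auto)
      also have "\<dots> = K3 * s * \<bar>b\<bar>" by (simp add: K3_def)
      finally show ?thesis .
    qed
    have "\<bar>hgt' \<delta> b t - (hgt' \<delta> b 0 * cos (\<omega> * t) + 0 / \<omega> * sin (\<omega> * t))\<bar> \<le> K3 * s * \<bar>b\<bar> * t"
    proof (rule forced_oscillator[where u = "hgt \<delta> b" and
          h = "\<lambda>\<tau>. snd (force \<delta> (z \<tau>)) + \<omega>\<^sup>2 * snd (z \<tau>)"])
      fix \<tau> assume \<tau>: "0 \<le> \<tau>" "\<tau> \<le> t"
      show "(hgt \<delta> b has_real_derivative hgt' \<delta> b \<tau>) (at \<tau>)" by (rule flow_components)
      show "(hgt' \<delta> b has_real_derivative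
          snd (force \<delta> (z \<tau>)) + \<omega>\<^sup>2 * snd (z \<tau>) - \<omega>\<^sup>2 * hgt \<delta> b \<tau>) (at \<tau>)"
        using flow_components(4)[of \<delta> b \<tau>] by (simp add: z_def)
      show "\<bar>snd (force \<delta> (z \<tau>)) + \<omega>\<^sup>2 * snd (z \<tau>) - 0\<bar> \<le> K3 * s * \<bar>b\<bar>"
        using vertical \<tau> t by simp
    qed (use \<omega>_pos t flow_0 in auto)
    also have "\<dots> \<le> K3 * s * \<bar>b\<bar> * S"
      using K t \<open>s \<ge> 0\<close> by (intro mult_left_mono) auto
    also have "\<dots> = K3 * S * (s * \<bar>b\<bar>)" by simp
    also have "\<dots> \<le> C * (s * \<bar>b\<bar>)"
      using C(4) \<open>s \<ge> 0\<close> by (intro mult_right_mono) auto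
    finally have "\<bar>hgt' \<delta> b t - b * cos (\<omega> * t)\<bar> \<le> C * s * \<bar>b\<bar>"
      by (simp add: flow_0 mult.assoc)
    then show ?thesis using rad' rad_ge[OF t] by (simp add: s_def z_def)
  qed
  show thesis by (rule that[OF C(1) main])
qed

section \<open>Time-reversal symmetries and periodicity\<close>

lemma flow_reflect_0: "rad \<delta> b (- t) = rad \<delta> b t" "hgt \<delta> b (- t) = - hgt \<delta> b t"
  if "\<bar>\<delta>\<bar> \<le> 1"
proof -
  obtain M where M: "\<And>\<delta>. \<bar>\<delta>\<bar> \<le> 1 \<Longrightarrow> M-lipschitz_on UNIV (newton (force \<delta>))"
    by (rule force_lipschitz) blast
  \<comment> \<open>\<open>antiprism_f\<close> and \<open>antiprism_g\<close> are even in d; the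
    reflection d -> -d fixes the position (r0, 0) and negates the velocity (0, b).\<close>
  have "flow \<delta> b (- t) = ((\<lambda>z. (fst z, - snd z)) (fst (flow \<delta> b t)), - (\<lambda>z. (fst z, - snd z)) (snd (flow \<delta> b t)))"
  proof (rule newton_reversal[OF M[OF that] flow_deriv])
    show "bounded_linear (\<lambda>z::real \<times> real. (fst z, - snd z))"
      by (intro bounded_linear_Pair bounded_linear_fst bounded_linear_minus bounded_linear_snd)
    show "force \<delta> (fst z, - snd z) = (fst (force \<delta> z), - snd (force \<delta> z))" for z
      by (simp add: force_def antiprism_acc_def antiprism_f_def antiprism_g_def)
  qed (simp_all add: flow_0)
  then show "rad \<delta> b (- t) = rad \<delta> b t" "hgt \<delta> b (- t) = - hgt \<delta> b t" by simp_all
qed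

lemma flow_reflect_turning_point:
  assumes "\<bar>\<delta>\<bar> \<le> 1" "rad' \<delta> b T = 0" "hgt' \<delta> b T = 0"
  shows "rad \<delta> b (T - t) = rad \<delta> b (T + t)" "hgt \<delta> b (T - t) = hgt \<delta> b (T + t)"
proof -
  obtain M where M: "\<And>\<delta>. \<bar>\<delta>\<bar> \<le> 1 \<Longrightarrow> M-lipschitz_on UNIV (newton (force \<delta>))"
    by (rule force_lipschitz) blast
  \<comment> \<open>At a turning point the velocity is 0, so the identity meets both initial
    conditions.\<close>
  have "flow \<delta> b (T + (- t)) = (id (fst (flow \<delta> b (T + t))), - id (snd (flow \<delta> b (T + t))))"
  proof (rule newton_reversal[OF M[OF assms(1)], where x = "\<lambda>t. flow \<delta> b (T + t)"])
    have "((+) T has_vector_derivative 1) (at t)" for t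
      by (auto intro!: derivative_eq_intros)
    from vector_diff_chain_at[OF this flow_deriv]
    show "((\<lambda>t. flow \<delta> b (T + t)) has_vector_derivative newton (force \<delta>) (flow \<delta> b (T + t))) (at t)" for t
      by (simp add: o_def)
    show "bounded_linear (id :: real \<times> real \<Rightarrow> _)" by (simp add: id_def bounded_linear_ident)
  qed (use assms in \<open>auto simp: prod_eq_iff\<close>)
  then show "rad \<delta> b (T - t) = rad \<delta> b (T + t)" "hgt \<delta> b (T - t) = hgt \<delta> b (T + t)"
    by simp_all
qed

text \<open>The reflections about 0 and T compose to the shift by 2 * T, which keeps r and negates
  d; applying it twice gives the period 4 * T. The lower bound on r spreads from [0, T] to the whole
  line, so the truncated flow solves the original equations. \<open>A0 + \<delta> \<ge> 0\<close>
  ensures a^2 = A0 + \<delta>.\<close>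

lemma periodic_solution:
  assumes \<delta>: "\<bar>\<delta>\<bar> \<le> 1" "A0 + \<delta> \<ge> 0" and "T > 0"
    and turn: "rad' \<delta> b T = 0" "hgt' \<delta> b T = 0"
    and ge: "\<And>t. 0 \<le> t \<Longrightarrow> t \<le> T \<Longrightarrow> r0 / 2 \<le> rad \<delta> b t"
  defines "a \<equiv> sqrt (A0 + \<delta>)"
  shows "ivp_solution N m r0 a b UNIV (R N m r0 a b) (D N m r0 a b) \<and>
    (\<forall>t. R N m r0 a b (t + 4 * T) = R N m r0 a b t) \<and>
    (\<forall>t. D N m r0 a b (t + 4 * T) = D N m r0 a b t) \<and>
    solves_system_I N m r0 a b T"
proof -
  have shift: "rad \<delta> b (t + 2 * T) = rad \<delta> b t" "hgt \<delta> b (t + 2 * T) = - hgt \<delta> b t" for t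
    using flow_reflect_turning_point[OF \<delta>(1) turn, of "T + t"] flow_reflect_0[OF \<delta>(1), of b t]
    by (simp_all add: algebra_simps)
  have rad_abs: "rad \<delta> b \<bar>t\<bar> = rad \<delta> b t" for t
    by (simp add: abs_if flow_reflect_0(1)[OF \<delta>(1)])
  \<comment> \<open>Evenness of r gives [-T, T]; each further shift by 2 * T widens the symmetric
    interval by 2 * T on both sides.\<close>
  have "\<forall>t. \<bar>t\<bar> \<le> T + 2 * T * real n \<longrightarrow> r0 / 2 \<le> rad \<delta> b t" for n
  proof (induction n)
    case 0
    show ?case using ge[of "\<bar>t\<bar>" for t] by (simp add: rad_abs)
  next
    case (Suc n)
    have pos: "r0 / 2 \<le> rad \<delta> b t" if "0 \<le> t" "t \<le> T + 2 * T * real (Suc n)" for t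
    proof -
      have "\<bar>t - 2 * T\<bar> \<le> T + 2 * T * real n \<or> \<bar>t\<bar> \<le> T + 2 * T * real n"
      proof -
        have "2 * T * real n \<ge> 0" using \<open>T > 0\<close> by simp
        moreover have "2 * T * real (Suc n) = 2 * T * real n + 2 * T" by (simp add: algebra_simps)
        ultimately show ?thesis using that \<open>T > 0\<close> by linarith
      qed
      then show ?thesis using Suc shift(1)[of "t - 2 * T"] by auto
    qed
    show ?case using pos[of "\<bar>t\<bar>" for t] by (simp add: rad_abs)
  qed
  moreover have "\<exists>n. \<bar>t\<bar> \<le> T + 2 * T * real n" for t
  proof -
    obtain n where "\<bar>t\<bar> / (2 * T) \<le> real n" using real_arch_simple by blast
    then show ?thesis using \<open>T > 0\<close> by (intro exI[of _ n]) (simp add: field_simps)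
  qed
  ultimately have rad_ge: "r0 / 2 \<le> rad \<delta> b t" for t by blast
  then have rad_pos: "rad \<delta> b t > 0" for t using r0 by (meson half_r0 less_le_trans)
  have "ivp_solution N m r0 a b UNIV (rad \<delta> b) (hgt \<delta> b)"
  proof (rule ivp_solutionI)
    fix t
    have R: "max (rad \<delta> b t) (r0 / 2) = rad \<delta> b t" using rad_ge[of t] by simp
    show "(rad \<delta> b has_real_derivative rad' \<delta> b t) (at t)" "(hgt \<delta> b has_real_derivative hgt' \<delta> b t) (at t)"
      by (rule flow_components)+
    show "(rad' \<delta> b has_real_derivative
        a\<^sup>2 / rad \<delta> b t ^ 3 - 2 * rad \<delta> b t * m * antiprism_f N (rad \<delta> b t) (hgt \<delta> b t)) (at t)"
      using flow_components(3)[of \<delta> b t] \<delta>(2) by (simp add: force_def antiprism_acc_def R a_def)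
    show "(hgt' \<delta> b has_real_derivative
        - (m * hgt \<delta> b t / 2) * antiprism_g N (rad \<delta> b t) (hgt \<delta> b t)) (at t)"
      using flow_components(4)[of \<delta> b t] by (simp add: force_def antiprism_acc_def R)
  qed (use rad_pos in \<open>auto simp: flow_0\<close>)
  note sol = this
  note RD = R_D_eq_global_solution[OF sol]
  have "rad \<delta> b (t + 4 * T) = rad \<delta> b t" "hgt \<delta> b (t + 4 * T) = hgt \<delta> b t" for t
    using shift[of t] shift[of "t + 2 * T"] by (simp_all add: algebra_simps)
  moreover have "solves_system_I N m r0 a b T"
    unfolding solves_system_I_def RD
    using \<open>T > 0\<close> flow_components(1,2)[of \<delta> b T] turn by simp
  ultimately show ?thesis using sol by (simp add: RD)
qed

section \<open>Turning points\<close>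

text \<open>The flow is Lipschitz in \<delta> uniformly in t, and continuous in t for each fixed
  \<delta>.\<close>

lemma flow_jointly_continuous:
  assumes "A \<subseteq> {-1..1} \<times> {0..S}"
  shows "continuous_on A (\<lambda>z. flow (fst z) b (snd z))"
  unfolding continuous_on_def
proof
  fix z0 assume "z0 \<in> A"
  obtain C where C: "C > 0" "\<And>\<delta> \<delta>' b b' t. \<bar>\<delta>\<bar> \<le> 1 \<Longrightarrow> \<bar>\<delta>'\<bar> \<le> 1 \<Longrightarrow> 0 \<le> t \<Longrightarrow> t \<le> S \<Longrightarrow>
    norm (flow \<delta> b t - flow \<delta>' b' t) \<le> C * (\<bar>\<delta> - \<delta>'\<bar> + \<bar>b - b'\<bar>)"
    by (rule flow_lipschitz) blast
  define g where "g z = C * \<bar>fst z - fst z0\<bar> + norm (flow (fst z0) b (snd z) - flow (fst z0) b (snd z0))"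
    for z :: "real \<times> real"
  have "((\<lambda>z. flow (fst z) b (snd z) - flow (fst z0) b (snd z0)) \<longlongrightarrow> 0) (at z0 within A)"
  proof (rule Lim_null_comparison)
    show "\<forall>\<^sub>F z in at z0 within A. norm (flow (fst z) b (snd z) - flow (fst z0) b (snd z0)) \<le> g z"
      unfolding eventually_at_topological
    proof (intro exI[of _ UNIV] conjI ballI impI)
      fix z assume "z \<in> A"
      then have "\<bar>fst z\<bar> \<le> 1" "\<bar>fst z0\<bar> \<le> 1" "0 \<le> snd z" "snd z \<le> S"
        using subsetD[OF assms \<open>z \<in> A\<close>] subsetD[OF assms \<open>z0 \<in> A\<close>]
        by (auto simp: mem_Times_iff abs_le_iff)
      from C(2)[OF this, of b b]
      have "norm (flow (fst z) b (snd z) - flow (fst z0) b (snd z)) \<le> C * \<bar>fst z - fst z0\<bar>" by simp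
      then show "norm (flow (fst z) b (snd z) - flow (fst z0) b (snd z0)) \<le> g z"
        unfolding g_def
        using norm_triangle_ineq[of "flow (fst z) b (snd z) - flow (fst z0) b (snd z)"
            "flow (fst z0) b (snd z) - flow (fst z0) b (snd z0)"] by simp
    qed auto
    have "isCont (flow (fst z0) b) (snd z0)"
      using flow_deriv has_vector_derivative_continuous by blast
    then have "((\<lambda>z. flow (fst z0) b (snd z)) \<longlongrightarrow> flow (fst z0) b (snd z0)) (at z0 within A)"
      by (rule isCont_tendsto_compose) (intro tendsto_intros)
    then have "(g \<longlongrightarrow> C * \<bar>fst z0 - fst z0\<bar> + norm (flow (fst z0) b (snd z0) - flow (fst z0) b (snd z0)))
        (at z0 within A)"
      unfolding g_def by (intro tendsto_intros)
    then show "(g \<longlongrightarrow> 0) (at z0 within A)" by simp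
  qed
  then show "((\<lambda>z. flow (fst z) b (snd z)) \<longlongrightarrow> flow (fst z0) b (snd z0)) (at z0 within A)"
    by (rule LIM_zero_cancel)
qed

lemma turning_points_exist:
  obtains bhat where "bhat > 0" "\<And>b. \<bar>b\<bar> < bhat \<Longrightarrow> b \<noteq> 0 \<Longrightarrow> \<exists>\<delta> T. \<bar>\<delta>\<bar> \<le> 1 \<and> A0 + \<delta> \<ge> 0 \<and> T > 0 \<and>
    rad' \<delta> b T = 0 \<and> hgt' \<delta> b T = 0 \<and> (\<forall>t. 0 \<le> t \<longrightarrow> t \<le> T \<longrightarrow> r0 / 2 \<le> rad \<delta> b t)"
proof -
  define T0 where "T0 = pi / (2 * \<omega>)"
  have "T0 > 0" using \<omega>_pos by (simp add: T0_def)
  have "T0 < pi / \<nu>"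
    unfolding T0_def using \<nu>_pos \<omega>_pos \<nu>_less by (intro divide_strict_left_mono) auto
  \<comment> \<open>\<open>T0\<close> is the time at which cos (\<omega> * t) first vanishes. S < 2
    * \<open>T0\<close> keeps the cosine negative at S, and S < pi / \<nu> keeps sin (\<nu> * t)
    positive up to S.\<close>
  then obtain S where S: "T0 < S" "S < 2 * T0" "S < pi / \<nu>"
    using dense[of T0 "min (2 * T0) (pi / \<nu>)"] \<open>T0 > 0\<close> by auto
  then have "S > 0" using \<open>T0 > 0\<close> by simp
  obtain C where C: "C > 0" and asym:
    "\<And>\<delta> b t. \<bar>\<delta>\<bar> \<le> 1 \<Longrightarrow> C * (\<bar>\<delta>\<bar> + \<bar>b\<bar>) \<le> r0 \<Longrightarrow> 0 \<le> t \<Longrightarrow> t \<le> S \<Longrightarrow>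
      r0 / 2 \<le> rad \<delta> b t \<and>
      \<bar>rad' \<delta> b t - \<delta> / (r0 ^ 3 * \<nu>) * sin (\<nu> * t)\<bar> \<le> C * ((\<bar>\<delta>\<bar> + \<bar>b\<bar>)\<^sup>2 + \<bar>b\<bar>) \<and>
      \<bar>hgt' \<delta> b t - b * cos (\<omega> * t)\<bar> \<le> C * (\<bar>\<delta>\<bar> + \<bar>b\<bar>) * \<bar>b\<bar>"
    using flow_asymptotics[OF \<open>S > 0\<close>] by blast
  have "compact {T0 / 2..S}" "{T0 / 2..S} \<noteq> {}" "continuous_on {T0 / 2..S} (\<lambda>t. sin (\<nu> * t))"
    using S \<open>T0 > 0\<close> by (auto intro!: continuous_intros)
  from continuous_attains_inf[OF this] obtain t0
    where t0: "t0 \<in> {T0 / 2..S}" "\<And>t. t \<in> {T0 / 2..S} \<Longrightarrow> sin (\<nu> * t0) \<le> sin (\<nu> * t)" by blast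
  \<comment> \<open>With the least sine over the time range: for \<delta> = \<open>\<delta>0\<close>
    the leading term of r' is at least \<open>\<delta>0 * \<sigma>\<close>, and for the opposite
    \<delta> at most its negative.\<close>
  define \<sigma> where "\<sigma> = sin (\<nu> * t0) / (r0 ^ 3 * \<nu>)"
  have "sin (\<nu> * t0) > 0"
  proof (rule sin_gt_zero)
    show "0 < \<nu> * t0" using t0(1) \<nu>_pos \<open>T0 > 0\<close> by auto
    have "\<nu> * t0 \<le> \<nu> * S" using t0(1) \<nu>_pos by auto
    also have "\<dots> < pi" using S(3) \<nu>_pos by (simp add: field_simps)
    finally show "\<nu> * t0 < pi" .
  qed
  then have "\<sigma> > 0" using r0 \<nu>_pos by (simp add: \<sigma>_def)
  \<comment> \<open>The margin by which cos (\<omega> * t) is positive at T0 / 2 and negative at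
    S.\<close>
  define \<kappa> where "\<kappa> = min (cos (\<omega> * (T0 / 2))) (- cos (\<omega> * S))"
  have "\<kappa> > 0"
  proof -
    have \<omega>T0: "\<omega> * (T0 / 2) = pi / 4" "\<omega> * T0 = pi / 2" using \<omega>_pos by (simp_all add: T0_def)
    have "\<omega> * T0 < \<omega> * S" "\<omega> * S < \<omega> * (2 * T0)" using S \<omega>_pos by simp_all
    then have "pi / 2 < \<omega> * S" "\<omega> * S \<le> pi" using \<omega>T0(2) by simp_all
    then have "cos (\<omega> * S) < cos (pi / 2)" by (intro cos_monotone_0_pi) auto
    moreover have "cos (\<omega> * (T0 / 2)) > 0" unfolding \<omega>T0(1) by (intro cos_gt_zero) auto
    ultimately have "cos (\<omega> * S) < 0" "cos (\<omega> * (T0 / 2)) > 0" by simp_all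
    then show ?thesis by (simp add: \<kappa>_def)
  qed
  \<comment> \<open>The bounds 1 and \<open>A0\<close> keep \<delta> admissible and a^2 nonnegative,
    and r0 / (2 * C) meets the smallness condition of the asymptotics. The last two make the
    vertical error 2 * C * \<open>\<delta>0\<close> at most half of \<kappa> and the radial factor 5
    * C * \<open>\<delta>0\<close> at most half of \<sigma>.\<close>
  define \<delta>0 where "\<delta>0 = min (min 1 A0) (min (r0 / (2 * C)) (min (\<kappa> / (4 * C)) (\<sigma> / (10 * C))))"
  have \<delta>0: "\<delta>0 > 0" "\<delta>0 \<le> 1" "\<delta>0 \<le> A0" "\<delta>0 \<le> r0 / (2 * C)" "\<delta>0 \<le> \<kappa> / (4 * C)" "\<delta>0 \<le> \<sigma> / (10 * C)"
    using A0_pos r0 C \<open>\<kappa> > 0\<close> \<open>\<sigma> > 0\<close> by (auto simp: \<delta>0_def)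
  \<comment> \<open>With |b| below \<open>\<delta>0\<^sup>2\<close> the radial error, at most C * (4
    + 1) * \<open>\<delta>0\<^sup>2\<close>, is of second order, whereas the leading term is of
    first order in \<open>\<delta>0\<close>.\<close>
  have "\<exists>\<delta> T. \<bar>\<delta>\<bar> \<le> 1 \<and> A0 + \<delta> \<ge> 0 \<and> T > 0 \<and> rad' \<delta> b T = 0 \<and> hgt' \<delta> b T = 0 \<and>
      (\<forall>t. 0 \<le> t \<longrightarrow> t \<le> T \<longrightarrow> r0 / 2 \<le> rad \<delta> b t)"
    if b: "\<bar>b\<bar> < \<delta>0\<^sup>2" "b \<noteq> 0" for b
  proof -
    have "\<delta>0\<^sup>2 \<le> \<delta>0" using \<delta>0(1,2) by (simp add: power2_eq_square mult_left_le)
    have sum_le: "\<bar>\<delta>\<bar> + \<bar>b\<bar> \<le> 2 * \<delta>0" if "\<bar>\<delta>\<bar> \<le> \<delta>0" for \<delta>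
      using that b(1) \<open>\<delta>0\<^sup>2 \<le> \<delta>0\<close> by linarith
    have small: "C * (\<bar>\<delta>\<bar> + \<bar>b\<bar>) \<le> r0" if "\<bar>\<delta>\<bar> \<le> \<delta>0" for \<delta>
    proof -
      have "C * (\<bar>\<delta>\<bar> + \<bar>b\<bar>) \<le> C * (2 * \<delta>0)" using sum_le[OF that] C by simp
      also have "\<dots> \<le> r0" using \<delta>0(4) C by (simp add: field_simps)
      finally show ?thesis .
    qed
    have vertical: "\<bar>hgt' \<delta> b t / b - cos (\<omega> * t)\<bar> < \<kappa>" if "\<bar>\<delta>\<bar> \<le> \<delta>0" "0 \<le> t" "t \<le> S" for \<delta> t
    proof -
      have "\<bar>hgt' \<delta> b t / b - cos (\<omega> * t)\<bar> = \<bar>hgt' \<delta> b t - b * cos (\<omega> * t)\<bar> / \<bar>b\<bar>"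
        using b(2) by (simp add: diff_divide_distrib flip: abs_divide)
      also have "\<dots> \<le> C * (\<bar>\<delta>\<bar> + \<bar>b\<bar>) * \<bar>b\<bar> / \<bar>b\<bar>"
        using asym[OF _ small[OF that(1)] that(2,3)] that(1) \<delta>0(2) by (intro divide_right_mono) auto
      also have "\<dots> \<le> C * (2 * \<delta>0)" using sum_le[OF that(1)] C b(2) by simp
      also have "\<dots> < \<kappa>" using \<delta>0(5) C \<open>\<kappa> > 0\<close> by (simp add: field_simps)
      finally show ?thesis .
    qed
    have radial: "\<bar>rad' \<delta> b t - \<delta> / (r0 ^ 3 * \<nu>) * sin (\<nu> * t)\<bar> < \<delta>0 * \<sigma>"
      if "\<bar>\<delta>\<bar> \<le> \<delta>0" "0 \<le> t" "t \<le> S" for \<delta> t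
    proof -
      have "\<bar>rad' \<delta> b t - \<delta> / (r0 ^ 3 * \<nu>) * sin (\<nu> * t)\<bar> \<le> C * ((\<bar>\<delta>\<bar> + \<bar>b\<bar>)\<^sup>2 + \<bar>b\<bar>)"
        using asym[OF _ small[OF that(1)] that(2,3)] that(1) \<delta>0(2) by auto
      also have "\<dots> \<le> C * ((2 * \<delta>0)\<^sup>2 + \<delta>0\<^sup>2)"
        using C b(1) sum_le[OF that(1)] by (intro mult_left_mono add_mono power_mono) auto
      also have "\<dots> = \<delta>0 * (5 * C * \<delta>0)" by (simp add: power2_eq_square algebra_simps)
      also have "\<dots> < \<delta>0 * \<sigma>"
        using \<delta>0(1,6) C \<open>\<sigma> > 0\<close> by (intro mult_strict_left_mono) (simp_all add: field_simps)
      finally show ?thesis .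
    qed
    have sub: "{-\<delta>0..\<delta>0} \<times> {T0 / 2..S} \<subseteq> {-1..1} \<times> {0..S}"
      using \<delta>0(2) \<open>T0 > 0\<close> by auto
    note cont = flow_jointly_continuous[OF sub, of b]
    have sin_ge: "\<delta>0 * \<sigma> \<le> \<delta>0 / (r0 ^ 3 * \<nu>) * sin (\<nu> * t)" if "t \<in> {T0 / 2..S}" for t
      using t0(2)[OF that] \<delta>0(1) r0 \<nu>_pos by (simp add: \<sigma>_def divide_right_mono mult_left_mono)
    \<comment> \<open>r' increases through 0 across the \<delta>-range, so its negative is used to
      obtain the required inward orientation; d' / b decreases in t already.\<close>
    obtain \<delta> T where sol: "\<delta> \<in> {-\<delta>0..\<delta>0}" "T \<in> {T0 / 2..S}"
      "- rad' (fst (\<delta>, T)) b (snd (\<delta>, T)) = 0" "hgt' (fst (\<delta>, T)) b (snd (\<delta>, T)) / b = 0"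
    proof (rule poincare_miranda)
      show "- \<delta>0 < \<delta>0" "T0 / 2 < S" using \<delta>0(1) S \<open>T0 > 0\<close> by auto
      show "continuous_on ({-\<delta>0..\<delta>0} \<times> {T0 / 2..S}) (\<lambda>z. - rad' (fst z) b (snd z))"
        by (intro continuous_intros cont)
      show "continuous_on ({-\<delta>0..\<delta>0} \<times> {T0 / 2..S}) (\<lambda>z. hgt' (fst z) b (snd z) / b)"
        using b(2) by (intro continuous_intros cont) auto
    next
      fix t assume t: "t \<in> {T0 / 2..S}"
      then have "0 \<le> t" "t \<le> S" using \<open>T0 > 0\<close> by auto
      with sin_ge[OF t] radial[of "-\<delta>0" t] radial[of \<delta>0 t] \<delta>0(1)
      show "- rad' (fst (-\<delta>0, t)) b (snd (-\<delta>0, t)) > 0" "- rad' (fst (\<delta>0, t)) b (snd (\<delta>0, t)) < 0"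
        by (auto simp: abs_less_iff)
    next
      fix \<delta> assume "\<delta> \<in> {-\<delta>0..\<delta>0}"
      then have "\<bar>\<delta>\<bar> \<le> \<delta>0" by (simp add: abs_le_iff)
      with vertical[of \<delta> "T0 / 2"] vertical[of \<delta> S] \<open>T0 > 0\<close> S
      show "hgt' (fst (\<delta>, T0 / 2)) b (snd (\<delta>, T0 / 2)) / b > 0" "hgt' (fst (\<delta>, S)) b (snd (\<delta>, S)) / b < 0"
        by (auto simp: \<kappa>_def abs_less_iff)
    qed auto
    have \<delta>: "\<bar>\<delta>\<bar> \<le> \<delta>0" using sol(1) by (simp add: abs_le_iff)
    have "r0 / 2 \<le> rad \<delta> b t" if "0 \<le> t" "t \<le> T" for t
      using asym[OF _ small[OF \<delta>] that(1)] that(2) sol(2) \<delta> \<delta>0(2) by auto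
    moreover have "\<bar>\<delta>\<bar> \<le> 1" "A0 + \<delta> \<ge> 0" "T > 0" using \<delta> \<delta>0(2,3) sol(2) \<open>T0 > 0\<close> by auto
    ultimately show ?thesis using sol(3,4) b(2) by auto
  qed
  then show thesis using \<delta>0(1) by (intro that[of "\<delta>0\<^sup>2"]) auto
qed

end

section \<open>Choice of the functions \<open>T\<close> and \<open>a\<close>\<close>

theorem theorem3:
  fixes N :: nat and m r0 :: real
  assumes "N > 1" and "m > 0" and "r0 > 0"
  shows "\<exists>bhat > 0. \<exists>T a :: real \<Rightarrow> real.
           T 0 = pi / 2 * sqrt (r0 ^ 3 / (m * antiprism_alpha N)) \<and>
           a 0 = sqrt (m * antiprism_gamma N * r0) \<and>
           (\<forall>b \<in> {-bhat<..<bhat}.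
              ivp_solution N m r0 (a b) b UNIV (R N m r0 (a b) b) (D N m r0 (a b) b) \<and>
              (\<forall>t. R N m r0 (a b) b (t + 4 * T b) = R N m r0 (a b) b t) \<and>
              (\<forall>t. D N m r0 (a b) b (t + 4 * T b) = D N m r0 (a b) b t) \<and>
              solves_system_I N m r0 (a b) b (T b))"
proof -
  interpret antiprism N m r0 using assms by unfold_locales
  define T0 where "T0 = pi / 2 * sqrt (r0 ^ 3 / (m * antiprism_alpha N))"
  have "T0 > 0"
    using antiprism_gamma_less[of N] assms by (simp add: T0_def)
  obtain bhat where "bhat > 0" and turn: "\<And>b. \<bar>b\<bar> < bhat \<Longrightarrow> b \<noteq> 0 \<Longrightarrow> \<exists>\<delta> T. \<bar>\<delta>\<bar> \<le> 1 \<and> A0 + \<delta> \<ge> 0 \<and> T > 0 \<and>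
    rad' \<delta> b T = 0 \<and> hgt' \<delta> b T = 0 \<and> (\<forall>t. 0 \<le> t \<longrightarrow> t \<le> T \<longrightarrow> r0 / 2 \<le> rad \<delta> b t)"
    by (rule turning_points_exist) blast
  \<comment> \<open>For b = 0 the flow with \<delta> = 0 is constant, so \<open>T0\<close> can be
    prescribed as a turning time; a constant solution has every period.\<close>
  have "\<exists>T \<delta>. (b = 0 \<longrightarrow> T = T0 \<and> \<delta> = 0) \<and> \<bar>\<delta>\<bar> \<le> 1 \<and> A0 + \<delta> \<ge> 0 \<and> T > 0 \<and>
    rad' \<delta> b T = 0 \<and> hgt' \<delta> b T = 0 \<and> (\<forall>t. 0 \<le> t \<longrightarrow> t \<le> T \<longrightarrow> r0 / 2 \<le> rad \<delta> b t)"
    if "\<bar>b\<bar> < bhat" for b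
  proof (cases "b = 0")
    case True
    then show ?thesis using \<open>T0 > 0\<close> A0_pos r0
      by (intro exI[of _ T0] exI[of _ 0]) (simp add: flow_equilibrium)
  next
    case False
    then show ?thesis using turn[OF that] by blast
  qed
  then obtain T \<delta> where T\<delta>: "\<And>b. \<bar>b\<bar> < bhat \<Longrightarrow> (b = 0 \<longrightarrow> T b = T0 \<and> \<delta> b = 0) \<and> \<bar>\<delta> b\<bar> \<le> 1 \<and>
      A0 + \<delta> b \<ge> 0 \<and> T b > 0 \<and> rad' (\<delta> b) b (T b) = 0 \<and> hgt' (\<delta> b) b (T b) = 0 \<and>
      (\<forall>t. 0 \<le> t \<longrightarrow> t \<le> T b \<longrightarrow> r0 / 2 \<le> rad (\<delta> b) b t)"
    by metis
  define a where "a b = sqrt (A0 + \<delta> b)" for b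
  show ?thesis
  proof (rule exI[of _ bhat], rule conjI[OF \<open>bhat > 0\<close>], rule exI[of _ T], rule exI[of _ a], intro conjI)
    show "T 0 = pi / 2 * sqrt (r0 ^ 3 / (m * antiprism_alpha N))"
      using T\<delta>[of 0] \<open>bhat > 0\<close> by (simp add: T0_def)
    show "a 0 = sqrt (m * antiprism_gamma N * r0)"
      using T\<delta>[of 0] \<open>bhat > 0\<close> by (simp add: a_def A0_def)
    show "\<forall>b \<in> {-bhat<..<bhat}.
              ivp_solution N m r0 (a b) b UNIV (R N m r0 (a b) b) (D N m r0 (a b) b) \<and>
              (\<forall>t. R N m r0 (a b) b (t + 4 * T b) = R N m r0 (a b) b t) \<and>
              (\<forall>t. D N m r0 (a b) b (t + 4 * T b) = D N m r0 (a b) b t) \<and>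
              solves_system_I N m r0 (a b) b (T b)"
      unfolding a_def
    proof
      fix b assume "b \<in> {-bhat<..<bhat}"
      then have "\<bar>b\<bar> < bhat" by (simp add: abs_less_iff)
      note * = T\<delta>[OF this]
      show "ivp_solution N m r0 (sqrt (A0 + \<delta> b)) b UNIV
          (R N m r0 (sqrt (A0 + \<delta> b)) b) (D N m r0 (sqrt (A0 + \<delta> b)) b) \<and>
          (\<forall>t. R N m r0 (sqrt (A0 + \<delta> b)) b (t + 4 * T b) = R N m r0 (sqrt (A0 + \<delta> b)) b t) \<and>
          (\<forall>t. D N m r0 (sqrt (A0 + \<delta> b)) b (t + 4 * T b) = D N m r0 (sqrt (A0 + \<delta> b)) b t) \<and>
          solves_system_I N m r0 (sqrt (A0 + \<delta> b)) b (T b)"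
        by (rule periodic_solution) (use * in blast)+
    qed
  qed
qed

end
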